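(* Let $X\succ 0$ denote the steady-state covariance of the state $x$ of a stable linear system $\dot x = Ax+Bu$ with $m$ inputs, where $A\in\mathbb{C}^{n\times n}$ and $B\in\mathbb{C}^{n\times m}$. If $Z$ satisfies the Lyapunov equation $AX+XA^*=-Z$, then $$0\le \nu(Z)\le m \qquad\text{and}\qquad \mu(A)\le \pi(Z)\le m .$$
   Context: Standing assumptions: $A\in\mathbb{C}^{n\times n}$ is Hurwitz (all eigenvalues have negative real part), $B\in\mathbb{C}^{n\times m}$ with $m\le n$, the pair $(A,B)$ is controllable, and $u(t)\in\mathbb{C}^m$ is a zero-mean stationary stochastic input (white or colored). The steady-state covariance is $X=\lim_{t\to\infty}\mathbf{E}\,(x(t)x^*(t))$. Known characterization of state covariances: a positive definite matrix $X$ is the steady-state covariance of $\dot x=Ax+Bu$ for some such input $u$ if and only if there is $H\in\mathbb{C}^{n\times m}$ with $AX+XA^*=-BH^*-HB^*$. For Hermitian $Z$, $\pi(Z)$ and $\nu(Z)$ denote the number of positive and negative eigenvalues of $Z$ (counted with multiplicity). $\mu(A)$ denotes the maximum of the geometric multiplicities of the eigenvalues of $A$. *)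

theory Defs
  imports "HOL-Probability.Probability" "HOL-Computational_Algebra.Polynomial"
begin

section \<open>Matrices and eigenvalues\<close>

definition adjoint_mat :: "complex^'n^'m \<Rightarrow> complex^'m^'n" where
  "adjoint_mat A = (\<chi> i j. cnj (A $ j $ i))"

definition hermitian_mat :: "complex^'n^'n \<Rightarrow> bool" where
  "hermitian_mat A \<longleftrightarrow> adjoint_mat A = A"

definition pos_def_mat :: "complex^'n^'n \<Rightarrow> bool" where
  "pos_def_mat X \<longleftrightarrow> hermitian_mat X \<and>
     (\<forall>v. v \<noteq> 0 \<longrightarrow> 0 < Re (\<Sum>i\<in>UNIV. cnj (v $ i) * (X *v v) $ i))"

text \<open>The product \<open>x y\<^sup>*\<close> of a column vector and a row vector.\<close>

definition outer :: "complex^'n \<Rightarrow> complex^'m \<Rightarrow> complex^'m^'n" where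
  "outer x y = (\<chi> i j. x $ i * cnj (y $ j))"

definition eigenval :: "complex^'n^'n \<Rightarrow> complex \<Rightarrow> bool" where
  "eigenval A z \<longleftrightarrow> (\<exists>v. v \<noteq> 0 \<and> A *v v = z *s v)"

definition charpoly :: "complex^'n^'n \<Rightarrow> complex poly" where
  "charpoly A = det (\<chi> i j. (if i = j then [:0, 1:] else 0) - [:A $ i $ j:])"

definition alg_mult :: "complex^'n^'n \<Rightarrow> complex \<Rightarrow> nat" where
  "alg_mult A z = order z (charpoly A)"

definition geo_mult :: "complex^'n^'n \<Rightarrow> complex \<Rightarrow> nat" where
  "geo_mult A z = vec.dim {v. A *v v = z *s v}"

definition max_geo_mult :: "complex^'n^'n \<Rightarrow> nat" where
  "max_geo_mult A = Max (geo_mult A ` {z. eigenval A z})"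

text \<open>The next two notions are meant for Hermitian matrices, all of whose eigenvalues are real.\<close>

definition num_pos_eigenvals :: "complex^'n^'n \<Rightarrow> nat" where
  "num_pos_eigenvals Z =
     (\<Sum>r\<in>{r::real. 0 < r \<and> eigenval Z (of_real r)}. alg_mult Z (of_real r))"

definition num_neg_eigenvals :: "complex^'n^'n \<Rightarrow> nat" where
  "num_neg_eigenvals Z =
     (\<Sum>r\<in>{r::real. r < 0 \<and> eigenval Z (of_real r)}. alg_mult Z (of_real r))"

definition hurwitz :: "complex^'n^'n \<Rightarrow> bool" where
  "hurwitz A \<longleftrightarrow> (\<forall>z. eigenval A z \<longrightarrow> Re z < 0)"

text \<open>Every state can be steered to every other state in finite time by a (continuous) control.\<close>

definition controllable :: "complex^'n^'n \<Rightarrow> complex^'m^'n \<Rightarrow> bool" where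
  "controllable A B \<longleftrightarrow>
     (\<forall>x0 x1. \<exists>T>0. \<exists>(u :: real \<Rightarrow> complex^'m) (x :: real \<Rightarrow> complex^'n).
        continuous_on {0..T} u \<and> x 0 = x0 \<and> x T = x1 \<and>
        (\<forall>t\<in>{0..T}. (x has_vector_derivative (A *v x t + B *v u t)) (at t within {0..T})))"


section \<open>Linear systems driven by stationary noise\<close>

text \<open>
  White noise, and more generally noise whose spectral mass is infinite, is not a process with
  values at fixed times.  The input \<open>u\<close> is therefore represented by its time integral
  \<open>U t = \<integral>\<^sub>0\<^sup>t u\<close>: a zero-mean process with finite second moments whose increments are stationary
  in the wide sense.  The lemmas at the end show that this covers both an ordinary (colored) wide-sense
  stationary \<open>u\<close> and white noise of arbitrary intensity \<open>Q\<close> (\<open>E (U s) (U t)\<^sup>* = min s t Q\<close>).  Time runs over \<open>t \<ge> 0\<close>; values at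
  negative times are irrelevant.
\<close>

definition integrated_stationary_input ::
    "'w measure \<Rightarrow> (real \<Rightarrow> 'w \<Rightarrow> complex^'m) \<Rightarrow> bool" where
  "integrated_stationary_input M U \<longleftrightarrow>
     (\<forall>t\<ge>0. U t \<in> borel_measurable M \<and> integrable M (\<lambda>\<omega>. (norm (U t \<omega>))\<^sup>2)) \<and>
     (AE \<omega> in M. U 0 \<omega> = 0) \<and>
     (\<forall>t\<ge>0. (\<integral>\<omega>. U t \<omega> \<partial>M) = 0) \<and>
     (\<forall>h\<ge>0. \<forall>s\<ge>0. \<forall>t\<ge>0. \<forall>s'\<ge>0. \<forall>t'\<ge>0.
        (\<integral>\<omega>. outer (U (t + h) \<omega> - U (s + h) \<omega>) (U (t' + h) \<omega> - U (s' + h) \<omega>) \<partial>M) =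
        (\<integral>\<omega>. outer (U t \<omega> - U s \<omega>) (U t' \<omega> - U s' \<omega>) \<partial>M))"

text \<open>
  The equation \<open>dx/dt = A x + B u\<close>, integrated over \<open>[0, t]\<close>.  The noise enters additively, so the
  integrated equation is meaningful pathwise and no stochastic integral is needed.
  The initial state \<open>x 0\<close> is an arbitrary random vector with finite second moments.
\<close>

definition state_process ::
    "'w measure \<Rightarrow> complex^'n^'n \<Rightarrow> complex^'m^'n \<Rightarrow>
     (real \<Rightarrow> 'w \<Rightarrow> complex^'m) \<Rightarrow> (real \<Rightarrow> 'w \<Rightarrow> complex^'n) \<Rightarrow> bool" where
  "state_process M A B U x \<longleftrightarrow>
     (\<lambda>(t, \<omega>). x t \<omega>) \<in> borel_measurable (restrict_space lborel {0..} \<Otimes>\<^sub>M M) \<and>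
     (\<forall>t\<ge>0. integrable M (\<lambda>\<omega>. (norm (x t \<omega>))\<^sup>2)) \<and>
     (AE \<omega> in M. \<forall>t\<ge>0. set_integrable lborel {0..t} (\<lambda>s. x s \<omega>) \<and>
        x t \<omega> = x 0 \<omega> + A *v (LINT s:{0..t}|lborel. x s \<omega>) + B *v U t \<omega>)"

definition steady_state_covariance ::
    "'w measure \<Rightarrow> (real \<Rightarrow> 'w \<Rightarrow> complex^'n) \<Rightarrow> complex^'n^'n \<Rightarrow> bool" where
  "steady_state_covariance M x X \<longleftrightarrow>
     ((\<lambda>t. \<integral>\<omega>. outer (x t \<omega>) (x t \<omega>) \<partial>M) \<longlongrightarrow> X) at_top"


subsection \<open>White and colored noise are admissible inputs\<close>

lemma bounded_bilinear_outer:
  "bounded_bilinear (outer :: complex^'n \<Rightarrow> complex^'m \<Rightarrow> complex^'m^'n)"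
proof -
  have "bilinear (outer :: complex^'n \<Rightarrow> complex^'m \<Rightarrow> complex^'m^'n)"
    by (auto simp: bilinear_def linear_iff outer_def vec_eq_iff algebra_simps)
  then show ?thesis
    by (simp add: bilinear_conv_bounded_bilinear)
qed

lemma outer_norm_bound:
  obtains K where "K > 0" "\<And>x y. norm (outer (x::complex^'n) (y::complex^'m)) \<le> K * ((norm x)\<^sup>2 + (norm y)\<^sup>2)"
proof -
  obtain K where K: "K > 0" "\<And>x y. norm (outer (x::complex^'n) (y::complex^'m)) \<le> norm x * norm y * K"
    using bounded_bilinear.pos_bounded[OF bounded_bilinear_outer] by metis
  have "norm (outer x y) \<le> K * ((norm x)\<^sup>2 + (norm y)\<^sup>2)" for x :: "complex^'n" and y :: "complex^'m"
  proof -
    have "0 \<le> norm x * norm y" by simp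
    then have "norm x * norm y \<le> (norm x)\<^sup>2 + (norm y)\<^sup>2"
      using sum_squares_bound[of "norm x" "norm y"] by linarith
    then have "K * (norm x * norm y) \<le> K * ((norm x)\<^sup>2 + (norm y)\<^sup>2)"
      using K(1) by simp
    then show ?thesis
      using K(2)[of x y] by (simp add: mult.commute)
  qed
  with K(1) show ?thesis using that by blast
qed

lemma outer_measurable [measurable]:
  fixes f :: "'w \<Rightarrow> complex^'n" and g :: "'w \<Rightarrow> complex^'m"
  assumes "f \<in> borel_measurable M" "g \<in> borel_measurable M"
  shows "(\<lambda>\<omega>. outer (f \<omega>) (g \<omega>)) \<in> borel_measurable M"
proof (rule borel_measurable_continuous_Pair[OF assms])
  show "continuous_on UNIV (\<lambda>x. outer (fst x :: complex^'n) (snd x :: complex^'m))"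
    by (intro bounded_bilinear.continuous_on[OF bounded_bilinear_outer] continuous_intros)
qed

lemma outer_integrable:
  fixes f :: "'w \<Rightarrow> complex^'n" and g :: "'w \<Rightarrow> complex^'m"
  assumes [measurable]: "f \<in> borel_measurable M" "g \<in> borel_measurable M"
    and "integrable M (\<lambda>\<omega>. (norm (f \<omega>))\<^sup>2)" "integrable M (\<lambda>\<omega>. (norm (g \<omega>))\<^sup>2)"
  shows "integrable M (\<lambda>\<omega>. outer (f \<omega>) (g \<omega>))"
proof -
  obtain K where K: "K > 0" "\<And>x y. norm (outer (x::complex^'n) (y::complex^'m)) \<le> K * ((norm x)\<^sup>2 + (norm y)\<^sup>2)"
    using outer_norm_bound by blast
  have "integrable M (\<lambda>\<omega>. K * ((norm (f \<omega>))\<^sup>2 + (norm (g \<omega>))\<^sup>2))"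
    using assms by auto
  then show ?thesis
  proof (rule Bochner_Integration.integrable_bound)
    show "(\<lambda>\<omega>. outer (f \<omega>) (g \<omega>)) \<in> borel_measurable M"
      by (intro outer_measurable assms)
    show "AE \<omega> in M. norm (outer (f \<omega>) (g \<omega>)) \<le> norm (K * ((norm (f \<omega>))\<^sup>2 + (norm (g \<omega>))\<^sup>2))"
      unfolding real_norm_def by (intro AE_I2 order_trans[OF K(2) abs_ge_self])
  qed
qed

lemma white_noise_input:
  fixes U :: "real \<Rightarrow> 'w \<Rightarrow> complex^'m" and Q :: "complex^'m^'m"
  assumes "\<And>t. 0 \<le> t \<Longrightarrow> U t \<in> borel_measurable M"
    and "\<And>t. 0 \<le> t \<Longrightarrow> integrable M (\<lambda>\<omega>. (norm (U t \<omega>))\<^sup>2)"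
    and "AE \<omega> in M. U 0 \<omega> = 0"
    and "\<And>t. 0 \<le> t \<Longrightarrow> (\<integral>\<omega>. U t \<omega> \<partial>M) = 0"
    and cov: "\<And>s t. 0 \<le> s \<Longrightarrow> 0 \<le> t \<Longrightarrow> (\<integral>\<omega>. outer (U s \<omega>) (U t \<omega>) \<partial>M) = min s t *\<^sub>R Q"
  shows "integrated_stationary_input M U"
proof -
  have int: "integrable M (\<lambda>\<omega>. outer (U s \<omega>) (U t \<omega>))" if "0 \<le> s" "0 \<le> t" for s t
    by (intro outer_integrable assms(1,2) that)
  have incr: "(\<integral>\<omega>. outer (U t \<omega> - U s \<omega>) (U t' \<omega> - U s' \<omega>) \<partial>M)
      = (min t t' - min t s' - min s t' + min s s') *\<^sub>R Q"
    if "0 \<le> s" "0 \<le> t" "0 \<le> s'" "0 \<le> t'" for s t s' t'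
  proof -
    have "(\<integral>\<omega>. outer (U t \<omega> - U s \<omega>) (U t' \<omega> - U s' \<omega>) \<partial>M)
      = (\<integral>\<omega>. (outer (U t \<omega>) (U t' \<omega>) - outer (U t \<omega>) (U s' \<omega>))
           - (outer (U s \<omega>) (U t' \<omega>) - outer (U s \<omega>) (U s' \<omega>)) \<partial>M)"
      by (simp add: bounded_bilinear.diff_left[OF bounded_bilinear_outer]
          bounded_bilinear.diff_right[OF bounded_bilinear_outer] algebra_simps)
    also have "\<dots> = (min t t' *\<^sub>R Q - min t s' *\<^sub>R Q) - (min s t' *\<^sub>R Q - min s s' *\<^sub>R Q)"
      using that by (simp add: int cov)
    finally show ?thesis by (simp add: algebra_simps)
  qed
  show ?thesis
    unfolding integrated_stationary_input_def
  proof (intro conjI allI impI)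
    fix h s t s' t' :: real
    assume "h \<ge> 0" "s \<ge> 0" "t \<ge> 0" "s' \<ge> 0" "t' \<ge> 0"
    then show "(\<integral>\<omega>. outer (U (t + h) \<omega> - U (s + h) \<omega>) (U (t' + h) \<omega> - U (s' + h) \<omega>) \<partial>M) =
        (\<integral>\<omega>. outer (U t \<omega> - U s \<omega>) (U t' \<omega> - U s' \<omega>) \<partial>M)"
      by (subst (1 2) incr) (auto simp: min_def algebra_simps)
  qed (use assms(1-4) in blast)+
qed

lemma norm_square_eq_outer_trace: "(norm x)\<^sup>2 = Re (\<Sum>i\<in>UNIV. outer x x $ i $ i)"
  for x :: "complex^'m"
  by (simp add: norm_vec_def L2_set_def outer_def sum_nonneg cmod_power2)
    (simp add: power2_eq_square)

lemma bounded_linear_Re_trace: "bounded_linear (\<lambda>Y :: complex^'m^'m. Re (\<Sum>i\<in>UNIV. Y $ i $ i))"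
  by (intro bounded_linear_compose[OF bounded_linear_Re] bounded_linear_sum
      bounded_linear_compose[OF bounded_linear_vec_nth bounded_linear_vec_nth])

lemma colored_noise_input:
  fixes u :: "real \<Rightarrow> 'w \<Rightarrow> complex^'m"
  assumes "prob_space M"
    and u_meas [measurable]: "(\<lambda>(t, \<omega>). u t \<omega>) \<in> borel_measurable (lborel \<Otimes>\<^sub>M M)"
    and sq: "\<And>t. integrable M (\<lambda>\<omega>. (norm (u t \<omega>))\<^sup>2)"
    and mean: "\<And>t. (\<integral>\<omega>. u t \<omega> \<partial>M) = 0"
    and stat: "\<And>s t h. (\<integral>\<omega>. outer (u (s + h) \<omega>) (u (t + h) \<omega>) \<partial>M) = (\<integral>\<omega>. outer (u s \<omega>) (u t \<omega>) \<partial>M)"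
  shows "AE \<omega> in M. \<forall>t\<ge>0. set_integrable lborel {0..t} (\<lambda>s. u s \<omega>)"
    and "integrated_stationary_input M (\<lambda>t \<omega>. LINT s:{0..t}|lborel. u s \<omega>)"
proof -
  interpret prob_space M by fact
  interpret LM: pair_sigma_finite lborel M ..
  interpret LLM: pair_sigma_finite "lborel \<Otimes>\<^sub>M lborel :: (real \<times> real) measure" M
    by (simp add: pair_sigma_finite_def lborel_prod sigma_finite_lborel sigma_finite_measure_axioms)
  have u1 [measurable]: "u t \<in> borel_measurable M" for t
    using measurable_compose[OF measurable_Pair1' u_meas, of t] by simp
  define c where "c = (\<integral>\<omega>. (norm (u 0 \<omega>))\<^sup>2 \<partial>M)"
  have c: "(\<integral>\<omega>. (norm (u t \<omega>))\<^sup>2 \<partial>M) = c" for t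
  proof -
    have "(\<integral>\<omega>. (norm (u s \<omega>))\<^sup>2 \<partial>M) = Re (\<Sum>i\<in>UNIV. (\<integral>\<omega>. outer (u s \<omega>) (u s \<omega>) \<partial>M) $ i $ i)" for s
      unfolding norm_square_eq_outer_trace
      by (rule integral_bounded_linear[OF bounded_linear_Re_trace outer_integrable]) (use sq in auto)
    then show ?thesis
      using stat[of 0 t 0] by (simp add: c_def)
  qed
  define V where "V w \<omega> = (\<integral>s. w s *\<^sub>R u s \<omega> \<partial>lborel)" for w :: "real \<Rightarrow> real" and \<omega>
  define R where "R s t = (\<integral>\<omega>. outer (u s \<omega>) (u t \<omega>) \<partial>M)" for s t
  have V_meas [measurable]: "V w \<in> borel_measurable M" if "integrable lborel w" for w
  proof -
    have [measurable]: "w \<in> borel_measurable lborel" using that by auto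
    have "(\<lambda>(\<omega>, s). w s *\<^sub>R u s \<omega>) \<in> borel_measurable (M \<Otimes>\<^sub>M lborel)"
      by measurable
    then show ?thesis
      unfolding V_def by (rule lborel.borel_measurable_lebesgue_integral)
  qed
  have le_sq: "norm x \<le> 1 + (norm x)\<^sup>2" for x :: "complex^'m"
  proof -
    have "2 * norm x \<le> 1 + (norm x)\<^sup>2"
      using sum_squares_bound[of 1 "norm x"] by simp
    with norm_ge_zero[of x] show ?thesis by linarith
  qed
  have int1: "integrable (lborel \<Otimes>\<^sub>M M) (\<lambda>(s, \<omega>). w s *\<^sub>R u s \<omega>)" if w: "integrable lborel w" for w
  proof (rule LM.Fubini_integrable)
    have [measurable]: "w \<in> borel_measurable lborel" using that by auto
    show "(\<lambda>(s, \<omega>). w s *\<^sub>R u s \<omega>) \<in> borel_measurable (lborel \<Otimes>\<^sub>M M)"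
      by measurable
    have *: "integrable M (u s)" for s
    proof (rule Bochner_Integration.integrable_bound)
      show "integrable M (\<lambda>\<omega>. 1 + (norm (u s \<omega>))\<^sup>2)"
        using sq by auto
      show "AE \<omega> in M. norm (u s \<omega>) \<le> norm (1 + (norm (u s \<omega>))\<^sup>2)"
        using le_sq by auto
    qed auto
    then show "AE s in lborel. integrable M (\<lambda>\<omega>. case (s, \<omega>) of (s, \<omega>) \<Rightarrow> w s *\<^sub>R u s \<omega>)"
      by auto
    have bd: "(\<integral>\<omega>. norm (u s \<omega>) \<partial>M) \<le> 1 + c" for s
    proof -
      have "(\<integral>\<omega>. norm (u s \<omega>) \<partial>M) \<le> (\<integral>\<omega>. 1 + (norm (u s \<omega>))\<^sup>2 \<partial>M)"
        by (rule integral_mono) (use * sq le_sq in auto)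
      also have "\<dots> = 1 + c" using sq c by (simp add: prob_space)
      finally show ?thesis .
    qed
    have "integrable lborel (\<lambda>s. w s * (1 + c))" using w by simp
    then show "integrable lborel (\<lambda>s. \<integral>\<omega>. norm (case (s, \<omega>) of (s, \<omega>) \<Rightarrow> w s *\<^sub>R u s \<omega>) \<partial>M)"
      by (rule Bochner_Integration.integrable_bound)
        (use w bd in \<open>auto simp: abs_mult intro!: AE_I2 mult_left_mono order_trans[OF bd abs_ge_self]\<close>)
  qed
  have AE1: "AE \<omega> in M. integrable lborel (\<lambda>s. w s *\<^sub>R u s \<omega>)" if "integrable lborel w" for w
    using LM.AE_integrable_snd[OF int1[OF that]] by simp
  have mean_V: "(\<integral>\<omega>. V w \<omega> \<partial>M) = 0" if "integrable lborel w" for w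
    unfolding V_def using LM.Fubini_integral[OF int1[OF that]] by (simp add: mean)
  have cov: "integrable M (\<lambda>\<omega>. outer (V w \<omega>) (V w' \<omega>))"
    "(\<integral>\<omega>. outer (V w \<omega>) (V w' \<omega>) \<partial>M) = (\<integral>s. (\<integral>t. (w s * w' t) *\<^sub>R R s t \<partial>lborel) \<partial>lborel)"
    if w: "integrable lborel w" and w': "integrable lborel w'" for w w'
  proof -
    have [measurable]: "w \<in> borel_measurable lborel" "w' \<in> borel_measurable lborel"
      using w w' by auto
    define g where "g q = (w (fst (fst q)) * w' (snd (fst q))) *\<^sub>R
        outer (u (fst (fst q)) (snd q)) (u (snd (fst q)) (snd q))" for q
    have "(\<lambda>q. (fst (fst q), snd q)) \<in> ((lborel \<Otimes>\<^sub>M lborel) \<Otimes>\<^sub>M M) \<rightarrow>\<^sub>M (lborel \<Otimes>\<^sub>M M)"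
      "(\<lambda>q. (snd (fst q), snd q)) \<in> ((lborel \<Otimes>\<^sub>M lborel) \<Otimes>\<^sub>M M) \<rightarrow>\<^sub>M (lborel \<Otimes>\<^sub>M M)"
      by measurable
    from this[THEN measurable_compose, OF u_meas]
    have uu: "(\<lambda>q. u (fst (fst q)) (snd q)) \<in> borel_measurable ((lborel \<Otimes>\<^sub>M lborel) \<Otimes>\<^sub>M M)"
      "(\<lambda>q. u (snd (fst q)) (snd q)) \<in> borel_measurable ((lborel \<Otimes>\<^sub>M lborel) \<Otimes>\<^sub>M M)"
      by simp_all
    have "(\<lambda>q. w (fst (fst q)) * w' (snd (fst q))) \<in> borel_measurable ((lborel \<Otimes>\<^sub>M lborel) \<Otimes>\<^sub>M M)"
      by measurable
    then have [measurable]: "g \<in> borel_measurable ((lborel \<Otimes>\<^sub>M lborel) \<Otimes>\<^sub>M M)"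
      unfolding g_def by (intro borel_measurable_scaleR outer_measurable uu)
    have o: "integrable M (\<lambda>\<omega>. outer (u s \<omega>) (u t \<omega>))" for s t
      by (intro outer_integrable) (use sq in auto)
    obtain K where K: "K > 0" "\<And>x y. norm (outer (x::complex^'m) (y::complex^'m)) \<le> K * ((norm x)\<^sup>2 + (norm y)\<^sup>2)"
      using outer_norm_bound by blast
    have bd: "(\<integral>\<omega>. norm (outer (u s \<omega>) (u t \<omega>)) \<partial>M) \<le> K * (c + c)" for s t
    proof -
      have "(\<integral>\<omega>. norm (outer (u s \<omega>) (u t \<omega>)) \<partial>M) \<le> (\<integral>\<omega>. K * ((norm (u s \<omega>))\<^sup>2 + (norm (u t \<omega>))\<^sup>2) \<partial>M)"
        by (rule integral_mono) (use o sq K in auto)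
      also have "\<dots> = K * (c + c)" using sq c by simp
      finally show ?thesis .
    qed
    have bd': "(\<integral>\<omega>. norm (outer (u s \<omega>) (u t \<omega>)) \<partial>M) \<le> \<bar>K\<bar> * (2 * \<bar>c\<bar>)" for s t
      by (rule order_trans[OF bd]) (use K(1) in simp)
    have ww: "integrable (lborel \<Otimes>\<^sub>M lborel) (\<lambda>(s, t). w s * w' t)"
    proof (rule lborel_pair.Fubini_integrable)
      show "integrable lborel (\<lambda>s. \<integral>t. norm (case (s, t) of (s, t) \<Rightarrow> w s * w' t) \<partial>lborel)"
        using w by (simp add: abs_mult)
    qed (use w' in auto)
    have gi: "integrable ((lborel \<Otimes>\<^sub>M lborel) \<Otimes>\<^sub>M M) g"
    proof (rule LLM.Fubini_integrable)
      show "AE p in lborel \<Otimes>\<^sub>M lborel. integrable M (\<lambda>\<omega>. g (p, \<omega>))"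
        using o by (auto simp: g_def split_beta)
      have "integrable (lborel \<Otimes>\<^sub>M lborel) (\<lambda>p. (case p of (s, t) \<Rightarrow> w s * w' t) * (K * (c + c)))"
        using ww by simp
      then show "integrable (lborel \<Otimes>\<^sub>M lborel) (\<lambda>p. \<integral>\<omega>. norm (g (p, \<omega>)) \<partial>M)"
        by (rule Bochner_Integration.integrable_bound)
          (auto simp: g_def abs_mult split_beta intro!: AE_I2 mult_left_mono bd')
    qed fact
    have gi': "integrable ((lborel \<Otimes>\<^sub>M lborel) \<Otimes>\<^sub>M M) (\<lambda>(p, \<omega>). g (p, \<omega>))"
      using gi by simp
    have eq: "AE \<omega> in M. (\<integral>p. g (p, \<omega>) \<partial>(lborel \<Otimes>\<^sub>M lborel)) = outer (V w \<omega>) (V w' \<omega>)"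
      using AE1[OF w] AE1[OF w'] LLM.AE_integrable_snd[OF gi']
    proof eventually_elim
      fix \<omega>
      assume iw: "integrable lborel (\<lambda>s. w s *\<^sub>R u s \<omega>)" and iw': "integrable lborel (\<lambda>s. w' s *\<^sub>R u s \<omega>)"
        and ig: "integrable (lborel \<Otimes>\<^sub>M lborel) (\<lambda>p. g (p, \<omega>))"
      have "(\<integral>p. g (p, \<omega>) \<partial>(lborel \<Otimes>\<^sub>M lborel)) = (\<integral>s. (\<integral>t. g ((s, t), \<omega>) \<partial>lborel) \<partial>lborel)"
        using lborel_pair.integral_fst'[OF ig] by simp
      also have "\<dots> = (\<integral>s. (\<integral>t. outer (w s *\<^sub>R u s \<omega>) (w' t *\<^sub>R u t \<omega>) \<partial>lborel) \<partial>lborel)"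
        by (simp add: g_def bounded_bilinear.scaleR_left[OF bounded_bilinear_outer]
            bounded_bilinear.scaleR_right[OF bounded_bilinear_outer] mult.commute)
      also have "\<dots> = (\<integral>s. outer (w s *\<^sub>R u s \<omega>) (V w' \<omega>) \<partial>lborel)"
        unfolding V_def
        by (subst integral_bounded_linear[OF bounded_bilinear.bounded_linear_right[OF bounded_bilinear_outer] iw']) simp
      also have "\<dots> = outer (V w \<omega>) (V w' \<omega>)"
        using integral_bounded_linear[OF bounded_bilinear.bounded_linear_left[OF bounded_bilinear_outer] iw]
        by (simp add: V_def)
      finally show "(\<integral>p. g (p, \<omega>) \<partial>(lborel \<Otimes>\<^sub>M lborel)) = outer (V w \<omega>) (V w' \<omega>)" .
    qed
    show "integrable M (\<lambda>\<omega>. outer (V w \<omega>) (V w' \<omega>))"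
      by (rule integrable_cong_AE_imp[OF LLM.integrable_snd[OF gi']]) (use eq V_meas w w' in auto)
    have "(\<integral>\<omega>. outer (V w \<omega>) (V w' \<omega>) \<partial>M) = (\<integral>\<omega>. (\<integral>p. g (p, \<omega>) \<partial>(lborel \<Otimes>\<^sub>M lborel)) \<partial>M)"
      by (rule integral_cong_AE) (use eq V_meas w w' LLM.integrable_snd[OF gi'] in auto)
    also have "\<dots> = (\<integral>p. (\<integral>\<omega>. g (p, \<omega>) \<partial>M) \<partial>(lborel \<Otimes>\<^sub>M lborel))"
      using LLM.Fubini_integral[OF gi'] by simp
    also have "\<dots> = (\<integral>s. (\<integral>t. (\<integral>\<omega>. g ((s, t), \<omega>) \<partial>M) \<partial>lborel) \<partial>lborel)"
      using lborel_pair.integral_fst'[OF LLM.integrable_fst'[OF gi]] by simp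
    also have "\<dots> = (\<integral>s. (\<integral>t. (w s * w' t) *\<^sub>R R s t \<partial>lborel) \<partial>lborel)"
      by (simp add: g_def R_def)
    finally show "(\<integral>\<omega>. outer (V w \<omega>) (V w' \<omega>) \<partial>M) = (\<integral>s. (\<integral>t. (w s * w' t) *\<^sub>R R s t \<partial>lborel) \<partial>lborel)" .
  qed
  define U where "U t \<omega> = (LINT s:{0..t}|lborel. u s \<omega>)" for t \<omega>
  have ind: "integrable lborel (indicator {0..t} :: real \<Rightarrow> real)" for t :: real
    by (rule integrable_real_indicator) (auto simp: emeasure_lborel_Icc_eq)
  have UV: "U t = V (indicator {0..t})" for t
    by (simp add: fun_eq_iff U_def V_def set_lebesgue_integral_def)
  have "AE \<omega> in M. \<forall>n::nat. set_integrable lborel {0..real n} (\<lambda>s. u s \<omega>)"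
    unfolding AE_all_countable set_integrable_def using AE1[OF ind] by blast
  then show ae: "AE \<omega> in M. \<forall>t\<ge>0. set_integrable lborel {0..t} (\<lambda>s. u s \<omega>)"
  proof (eventually_elim, safe)
    fix \<omega> and t :: real
    assume *: "\<forall>n::nat. set_integrable lborel {0..real n} (\<lambda>s. u s \<omega>)"
    obtain n :: nat where "t \<le> real n" using real_arch_simple by blast
    then have "{0..t} \<subseteq> {0..real n}" by simp
    moreover have "set_integrable lborel {0..real n} (\<lambda>s. u s \<omega>)" using * by simp
    ultimately show "set_integrable lborel {0..t} (\<lambda>s. u s \<omega>)"
      by (metis set_integrable_subset sets_lborel atLeastAtMost_borel)
  qed
  define d where "d s t = (\<lambda>a. indicator {0..t} a - indicator {0..s} a :: real)" for s t :: real
  have d_int: "integrable lborel (d s t)" for s t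
    unfolding d_def by (intro Bochner_Integration.integrable_diff ind)
  have d_shift: "d (s + h) (t + h) (a + h) = d s t a" if "0 \<le> h" "0 \<le> s" "0 \<le> t" for s t h a
    using that by (auto simp: d_def indicator_def)
  have incr: "AE \<omega> in M. U t \<omega> - U s \<omega> = V (d s t) \<omega>" for s t
    using AE1[OF ind, of t] AE1[OF ind, of s]
    by eventually_elim (simp add: UV V_def d_def scaleR_diff_left)
  have incr_cov: "(\<integral>\<omega>. outer (U t \<omega> - U s \<omega>) (U t' \<omega> - U s' \<omega>) \<partial>M) =
      (\<integral>a. (\<integral>b. (d s t a * d s' t' b) *\<^sub>R R a b \<partial>lborel) \<partial>lborel)" for s t s' t'
  proof -
    have "(\<integral>\<omega>. outer (U t \<omega> - U s \<omega>) (U t' \<omega> - U s' \<omega>) \<partial>M)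
      = (\<integral>\<omega>. outer (V (d s t) \<omega>) (V (d s' t') \<omega>) \<partial>M)"
    proof (rule integral_cong_AE)
      show "AE \<omega> in M. outer (U t \<omega> - U s \<omega>) (U t' \<omega> - U s' \<omega>) = outer (V (d s t) \<omega>) (V (d s' t') \<omega>)"
        using incr[of t s] incr[of t' s'] by eventually_elim simp
    qed (use V_meas d_int ind in \<open>auto simp: UV intro!: outer_measurable borel_measurable_diff\<close>)
    then show ?thesis using cov(2)[OF d_int d_int] by simp
  qed
  have "integrated_stationary_input M U"
    unfolding integrated_stationary_input_def
  proof (intro conjI allI impI)
    fix t :: real
    assume "0 \<le> t"
    show "U t \<in> borel_measurable M"
      using V_meas[OF ind] by (simp add: UV)
    show "integrable M (\<lambda>\<omega>. (norm (U t \<omega>))\<^sup>2)"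
      unfolding norm_square_eq_outer_trace UV
      by (rule integrable_bounded_linear[OF bounded_linear_Re_trace cov(1)[OF ind ind]])
    show "(\<integral>\<omega>. U t \<omega> \<partial>M) = 0"
      using mean_V[OF ind] by (simp add: UV)
  next
    have "U 0 \<omega> = 0" for \<omega>
    proof -
      have "AE s in lborel. s \<noteq> (0::real)" by (rule AE_lborel_singleton)
      then have "AE s in lborel. indicator {0..0::real} s *\<^sub>R u s \<omega> = 0"
        by eventually_elim (auto simp: indicator_def)
      then show ?thesis
        unfolding U_def set_lebesgue_integral_def by (rule integral_eq_zero_AE)
    qed
    then show "AE \<omega> in M. U 0 \<omega> = 0" by simp
  next
    fix h s t s' t' :: real
    assume nn: "h \<ge> 0" "s \<ge> 0" "t \<ge> 0" "s' \<ge> 0" "t' \<ge> 0"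
    have shift: "(\<integral>a. f a \<partial>lborel) = (\<integral>a. f (a + h) \<partial>lborel)" for f :: "real \<Rightarrow> complex^'m^'m"
      using lborel_integral_real_affine[of 1 f h] by (simp add: add.commute)
    have "(\<integral>\<omega>. outer (U (t + h) \<omega> - U (s + h) \<omega>) (U (t' + h) \<omega> - U (s' + h) \<omega>) \<partial>M)
        = (\<integral>a. (\<integral>b. (d (s + h) (t + h) a * d (s' + h) (t' + h) b) *\<^sub>R R a b \<partial>lborel) \<partial>lborel)"
      by (rule incr_cov)
    also have "\<dots> = (\<integral>a. (\<integral>b. (d (s + h) (t + h) (a + h) * d (s' + h) (t' + h) (b + h)) *\<^sub>R
        R (a + h) (b + h) \<partial>lborel) \<partial>lborel)"
      by (subst shift) (intro Bochner_Integration.integral_cong refl shift)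
    also have "\<dots> = (\<integral>a. (\<integral>b. (d s t a * d s' t' b) *\<^sub>R R a b \<partial>lborel) \<partial>lborel)"
      using nn by (simp add: d_shift R_def stat)
    also have "\<dots> = (\<integral>\<omega>. outer (U t \<omega> - U s \<omega>) (U t' \<omega> - U s' \<omega>) \<partial>M)"
      by (rule incr_cov[symmetric])
    finally show "(\<integral>\<omega>. outer (U (t + h) \<omega> - U (s + h) \<omega>) (U (t' + h) \<omega> - U (s' + h) \<omega>) \<partial>M) =
        (\<integral>\<omega>. outer (U t \<omega> - U s \<omega>) (U t' \<omega> - U s' \<omega>) \<partial>M)" .
  qed
  then show "integrated_stationary_input M (\<lambda>t \<omega>. LINT s:{0..t}|lborel. u s \<omega>)"
    unfolding U_def[abs_def] .
qed

end

theory Submission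
  imports Defs "HOL-Computational_Algebra.Fundamental_Theorem_Algebra"
begin

text \<open>
  Write \<open>m\<close> for the number of inputs. Everything rests on the signs of the
  Hermitian form \<open>v\<^sup>* Z v\<close>, which by the Lyapunov equation equals \<open>- 2 Re (v\<^sup>* A X v)\<close> (\<open>lyapunov_form\<close>).

  \<^item> It vanishes on the kernel of \<open>B\<^sup>*\<close> (\<open>steady_state_form_zero\<close>). For such \<open>v\<close> the noise drops out of the equation of
    \<open>v\<^sup>* x\<close>, so the rate of change of its mean square converges to \<open>- v\<^sup>* Z v\<close>. As the mean square itself
    converges, this limit is \<open>0\<close>. This argument works directly on the process and
    bypasses the construction of a matrix \<open>H\<close> with \<open>Z = B H\<^sup>* + H B\<^sup>*\<close>.

  \<^item> It is positive on a subspace whose dimension is the geometric multiplicity of a given eigenvalue \<open>z\<close> of \<open>A\<close>: where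
    \<open>A X v = z X v\<close>, the form is \<open>- 2 Re z (v\<^sup>* X v)\<close>, and \<open>Re z < 0\<close> (\<open>geo_mult_le_card_pos\<close>).

  In an orthonormal eigenbasis (\<open>hermitian_orthonormal_eigenvectors\<close>) the form becomes \<open>\<Sum>i. d i \<bar>c i\<bar>\<^sup>2\<close>, and \<open>\<pi>(Z)\<close> and
  \<open>\<nu>(Z)\<close> are the numbers of positive and negative \<open>d i\<close> (\<open>sum_alg_mult_diagonalized\<close>). The form is definite on the span
  of the eigenvectors with eigenvalues of one sign, so this span meets the kernel of \<open>B\<^sup>*\<close> only in \<open>0\<close> and has dimension
  at most \<open>m\<close> (\<open>card_same_sign_le\<close>). Conversely, a subspace on which the form is positive has dimension at most \<open>\<pi>(Z)\<close>
  (\<open>dim_le_card_pos\<close>).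
\<close>

section \<open>Hermitian forms and dimension counting\<close>

definition cip :: "complex^'n \<Rightarrow> complex^'n \<Rightarrow> complex" where
  "cip v w = (\<Sum>i\<in>UNIV. cnj (v $ i) * w $ i)"

lemma cip_add_right: "cip v (x + y) = cip v x + cip v y"
  and cip_diff_right: "cip v (x - y) = cip v x - cip v y"
  and cip_minus_right: "cip v (- y) = - cip v y"
  and cip_zero_right: "cip v 0 = 0"
  and cip_zero_left: "cip 0 v = 0"
  and cip_scale_right: "cip v (c *s x) = c * cip v x"
  and cip_scale_left: "cip (c *s x) v = cnj c * cip x v"
  and cip_scaleR_right: "cip v (r *\<^sub>R x) = r *\<^sub>R cip v x"
  by (simp_all add: cip_def algebra_simps sum.distrib sum_subtractf sum_negf sum_distrib_left scaleR_sum_right)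

lemma cip_commute: "cip v w = cnj (cip w v)"
  by (simp add: cip_def mult.commute)

lemma cip_adjoint: "cip v (A *v w) = cip (adjoint_mat A *v v) w"
proof -
  have "cip v (A *v w) = (\<Sum>i\<in>UNIV. \<Sum>j\<in>UNIV. cnj (v $ i) * (A $ i $ j * w $ j))"
    by (simp add: cip_def matrix_vector_mult_def sum_distrib_left)
  also have "\<dots> = (\<Sum>j\<in>UNIV. \<Sum>i\<in>UNIV. cnj (v $ i) * (A $ i $ j * w $ j))"
    by (rule sum.swap)
  also have "\<dots> = cip (adjoint_mat A *v v) w"
    by (simp add: cip_def matrix_vector_mult_def adjoint_mat_def sum_distrib_left sum_distrib_right mult_ac)
  finally show ?thesis .
qed

lemma cip_mult_cnj_cip: "cip a x * cnj (cip b x) = cip a (outer x x *v b)"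
  by (simp add: cip_def outer_def matrix_vector_mult_def sum_distrib_left sum_distrib_right mult_ac)

lemma cip_self: "cip v v = of_real ((norm v)\<^sup>2)"
proof -
  have "cip v v = (\<Sum>i\<in>UNIV. of_real ((norm (v $ i))\<^sup>2))"
    unfolding cip_def by (intro sum.cong refl) (metis complex_norm_square mult.commute)
  then show ?thesis
    by (simp add: norm_vec_def L2_set_def sum_nonneg)
qed

lemma Re_cip: "Re (cip v w) = v \<bullet> w"
  by (simp add: cip_def inner_vec_def inner_complex_def)

lemma bounded_linear_cip: "bounded_linear (cip v)"
  unfolding linear_conv_bounded_linear[symmetric]
  by (intro linearI) (simp_all add: cip_add_right cip_scaleR_right)

lemma bounded_linear_cip_matrix:
  fixes a :: "complex^'n" and b :: "complex^'k"
  shows "bounded_linear (\<lambda>Y. cip a (Y *v b))"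
proof -
  have "(r *\<^sub>R Y) *v b = r *\<^sub>R (Y *v b)" for r and Y :: "complex^'k^'n"
    by (simp add: vec_eq_iff matrix_vector_mult_def scaleR_sum_right)
  then show ?thesis
    unfolding linear_conv_bounded_linear[symmetric]
    by (intro linearI) (simp_all add: cip_add_right cip_scaleR_right matrix_vector_mult_add_rdistrib)
qed

lemma adjoint_mat_mult: "adjoint_mat (A ** B) = adjoint_mat B ** adjoint_mat A"
  by (simp add: adjoint_mat_def matrix_matrix_mult_def vec_eq_iff mult.commute)

lemma adjoint_mat_adjoint_mat: "adjoint_mat (adjoint_mat A) = A"
  by (simp add: adjoint_mat_def vec_eq_iff)

text \<open>
  Transversality of two subspaces enters below in this form: a map with kernel one of them is injective on the other,
  and its codomain has a known dimension.
\<close>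

lemma dim_le_if_injective:
  fixes f :: "complex^'a \<Rightarrow> complex^'b"
  assumes S: "vec.subspace S" and f: "Vector_Spaces.linear (*s) (*s) f"
    and ker: "\<And>v. v \<in> S \<Longrightarrow> f v = 0 \<Longrightarrow> v = 0"
    and T: "f ` S \<subseteq> T"
  shows "vec.dim S \<le> vec.dim T"
proof -
  interpret f: Vector_Spaces.linear "(*s)" "(*s)" f by fact
  have "inj_on f S"
  proof (rule inj_onI)
    fix v w assume "v \<in> S" "w \<in> S" "f v = f w"
    then have "v - w \<in> S" "f (v - w) = 0" using S by (auto simp: vec.subspace_diff f.diff)
    then show "v = w" using ker by fastforce
  qed
  then have "inj_on f (vec.span S)" using S by (simp add: vec.span_eq_iff[THEN iffD2])
  then have "vec.dim S = vec.dim (f ` S)" by (rule vec.dim_image_eq[OF f, symmetric])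
  also have "\<dots> \<le> vec.dim T" using T by (rule vec.dim_subset)
  finally show ?thesis .
qed

section \<open>The Lyapunov equation as an identity of forms\<close>

lemma lyapunov_hermitian:
  fixes A X Z :: "complex^'n^'n"
  assumes X: "hermitian_mat X" and lyap: "A ** X + X ** adjoint_mat A = - Z"
  shows "hermitian_mat Z"
proof -
  have *: "Z = - (A ** X + X ** adjoint_mat A)" using lyap by simp
  have "adjoint_mat Z = - (adjoint_mat (A ** X) + adjoint_mat (X ** adjoint_mat A))"
    unfolding * by (simp add: adjoint_mat_def vec_eq_iff)
  also have "\<dots> = Z"
    using X by (simp add: * adjoint_mat_mult adjoint_mat_adjoint_mat hermitian_mat_def add.commute)
  finally show ?thesis by (simp add: hermitian_mat_def)
qed

lemma lyapunov_form:
  fixes A X Z :: "complex^'n^'n"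
  assumes X: "hermitian_mat X" and lyap: "A ** X + X ** adjoint_mat A = - Z"
  shows "Re (cip v (Z *v v)) = - 2 * Re (cip v (A *v (X *v v)))"
proof -
  have "Z = 0 - (A ** X + X ** adjoint_mat A)" using lyap by simp
  then have "Z *v v = (0 - (A ** X + X ** adjoint_mat A)) *v v" by (rule arg_cong)
  also have "\<dots> = - (A *v (X *v v) + X *v (adjoint_mat A *v v))"
    unfolding matrix_vector_mult_diff_rdistrib matrix_vector_mult_add_rdistrib
    by (simp add: matrix_vector_mul_assoc)
  finally have "cip v (Z *v v) = - (cip v (A *v (X *v v)) + cip v (X *v (adjoint_mat A *v v)))"
    by (simp add: cip_minus_right cip_add_right cip_diff_right)
  moreover have "cip v (X *v (adjoint_mat A *v v)) = cnj (cip v (A *v (X *v v)))"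
    using X unfolding cip_adjoint[of v X] cip_adjoint[of v A] hermitian_mat_def
    by (simp add: cip_commute[of "X *v v"])
  ultimately show ?thesis by simp
qed

section \<open>The second moment of an absolutely continuous process\<close>

lemma norm_mult_le_squares: "norm (a * cnj b) \<le> (norm a)\<^sup>2 + (norm (b::complex))\<^sup>2"
proof -
  have "2 * (norm a * norm b) \<le> (norm a)\<^sup>2 + (norm b)\<^sup>2"
    using sum_squares_bound[of "norm a" "norm b"] by simp
  moreover have "0 \<le> norm a * norm b" by simp
  ultimately have "norm a * norm b \<le> (norm a)\<^sup>2 + (norm b)\<^sup>2" by linarith
  then show ?thesis by (simp add: norm_mult)
qed

lemma borel_measurable_cnj [measurable]: "cnj \<in> borel_measurable borel"
  by (intro borel_measurable_continuous_onI continuous_intros)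

lemma integrable_mult_cnj:
  fixes f g :: "'w \<Rightarrow> complex"
  assumes [measurable]: "f \<in> borel_measurable M" "g \<in> borel_measurable M"
    and sq: "integrable M (\<lambda>\<omega>. (norm (f \<omega>))\<^sup>2)" "integrable M (\<lambda>\<omega>. (norm (g \<omega>))\<^sup>2)"
  shows "integrable M (\<lambda>\<omega>. f \<omega> * cnj (g \<omega>))"
proof (rule Bochner_Integration.integrable_bound)
  show "integrable M (\<lambda>\<omega>. (norm (f \<omega>))\<^sup>2 + (norm (g \<omega>))\<^sup>2)"
    using sq by simp
qed (auto intro!: AE_I2 norm_mult_le_squares)

text \<open>
  Fubini's theorem exchanges the expectation with the time integral, since mean squares that are bounded by
  \<open>K\<close> bound the correlations with \<open>\<xi>\<close> by \<open>2 K\<close>. The last claim says that an increment over a short time has a small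
  correlation with any variable of bounded mean square; it replaces pathwise estimates of the increment.
\<close>

lemma (in prob_space) correlation_with_time_integral:
  fixes g :: "real \<Rightarrow> 'a \<Rightarrow> complex" and \<xi> :: "'a \<Rightarrow> complex"
  assumes meas: "(\<lambda>(r, \<omega>). g r \<omega>) \<in> borel_measurable (restrict_space lborel {s..t} \<Otimes>\<^sub>M M)"
    and "s \<le> t"
    and gsq: "\<And>r. r \<in> {s..t} \<Longrightarrow> integrable M (\<lambda>\<omega>. (norm (g r \<omega>))\<^sup>2)"
    and gK: "\<And>r. r \<in> {s..t} \<Longrightarrow> (\<integral>\<omega>. (norm (g r \<omega>))\<^sup>2 \<partial>M) \<le> K"
    and xi[measurable]: "\<xi> \<in> borel_measurable M" and xisq: "integrable M (\<lambda>\<omega>. (norm (\<xi> \<omega>))\<^sup>2)"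
    and xiK: "(\<integral>\<omega>. (norm (\<xi> \<omega>))\<^sup>2 \<partial>M) \<le> K"
  shows "(\<lambda>\<omega>. LINT r:{s..t}|lborel. g r \<omega>) \<in> borel_measurable M"
    and "set_integrable lborel {s..t} (\<lambda>r. \<integral>\<omega>. \<xi> \<omega> * cnj (g r \<omega>) \<partial>M)"
    and "(\<integral>\<omega>. \<xi> \<omega> * cnj (LINT r:{s..t}|lborel. g r \<omega>) \<partial>M)
       = (LINT r:{s..t}|lborel. (\<integral>\<omega>. \<xi> \<omega> * cnj (g r \<omega>) \<partial>M))"
    and "norm (\<integral>\<omega>. \<xi> \<omega> * cnj (LINT r:{s..t}|lborel. g r \<omega>) \<partial>M) \<le> 2 * K * (t - s)"
proof -
  \<comment> \<open>Integrating over \<open>N\<close>, a finite measure, makes the bounded correlations integrable in time.\<close>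
  define N where "N = restrict_space lborel {s..t}"
  have spN: "space N = {s..t}" by (simp add: N_def space_restrict_space)
  have emN: "emeasure N (space N) = ennreal (t - s)"
    using \<open>s \<le> t\<close> by (simp add: N_def space_restrict_space emeasure_restrict_space)
  interpret N: finite_measure N
    by (rule finite_measureI) (simp add: emN)
  interpret NM: pair_sigma_finite N M ..
  note meas' [measurable] = meas[folded N_def]
  have g1 [measurable]: "g r \<in> borel_measurable M" if "r \<in> {s..t}" for r
    using measurable_compose[OF measurable_Pair1' meas', of r] that by (simp add: spN)
  have bd: "(\<integral>\<omega>. norm (\<xi> \<omega> * cnj (g r \<omega>)) \<partial>M) \<le> 2 * K" if "r \<in> {s..t}" for r
  proof -
    have "(\<integral>\<omega>. norm (\<xi> \<omega> * cnj (g r \<omega>)) \<partial>M) \<le> (\<integral>\<omega>. (norm (\<xi> \<omega>))\<^sup>2 + (norm (g r \<omega>))\<^sup>2 \<partial>M)"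
      using that by (intro integral_mono integrable_norm integrable_mult_cnj Bochner_Integration.integrable_add
          norm_mult_le_squares xisq gsq xi g1)
    also have "\<dots> \<le> 2 * K"
      using xisq gsq[OF that] xiK gK[OF that] by simp
    finally show ?thesis .
  qed
  have int: "integrable (N \<Otimes>\<^sub>M M) (\<lambda>(r, \<omega>). \<xi> \<omega> * cnj (g r \<omega>))"
  proof (rule NM.Fubini_integrable)
    show "AE r in N. integrable M (\<lambda>\<omega>. case (r, \<omega>) of (r, \<omega>) \<Rightarrow> \<xi> \<omega> * cnj (g r \<omega>))"
      using gsq g1 xi xisq by (intro AE_I2) (auto simp: spN intro!: integrable_mult_cnj)
    show "integrable N (\<lambda>r. \<integral>\<omega>. norm (case (r, \<omega>) of (r, \<omega>) \<Rightarrow> \<xi> \<omega> * cnj (g r \<omega>)) \<partial>M)"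
    proof (rule N.integrable_const_bound[of _ "2 * K"])
      show "AE r in N. norm (\<integral>\<omega>. norm (case (r, \<omega>) of (r, \<omega>) \<Rightarrow> \<xi> \<omega> * cnj (g r \<omega>)) \<partial>M) \<le> 2 * K"
        using bd by (intro AE_I2) (simp add: spN)
    qed measurable
  qed measurable
  have restr: "(LINT r:{s..t}|lborel. f r) = (\<integral>r. f r \<partial>N)" for f :: "real \<Rightarrow> complex"
    unfolding N_def set_lebesgue_integral_def by (subst integral_restrict_space) auto
  have "(\<lambda>(\<omega>, r). g r \<omega>) \<in> borel_measurable (M \<Otimes>\<^sub>M N)"
    using measurable_compose[OF measurable_pair_swap' meas'] by (simp add: split_beta')
  then show "(\<lambda>\<omega>. LINT r:{s..t}|lborel. g r \<omega>) \<in> borel_measurable M"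
    unfolding restr by (rule N.borel_measurable_lebesgue_integral)
  have int': "integrable N (\<lambda>r. \<integral>\<omega>. \<xi> \<omega> * cnj (g r \<omega>) \<partial>M)"
    using NM.integrable_fst'[OF int] by simp
  then show "set_integrable lborel {s..t} (\<lambda>r. \<integral>\<omega>. \<xi> \<omega> * cnj (g r \<omega>) \<partial>M)"
    unfolding N_def set_integrable_def by (subst (asm) integrable_restrict_space) auto
  have swap: "(\<integral>\<omega>. \<xi> \<omega> * cnj (LINT r:{s..t}|lborel. g r \<omega>) \<partial>M)
       = (\<integral>r. (\<integral>\<omega>. \<xi> \<omega> * cnj (g r \<omega>) \<partial>M) \<partial>N)"
    using NM.Fubini_integral[OF int] by (simp add: restr)
  then show "(\<integral>\<omega>. \<xi> \<omega> * cnj (LINT r:{s..t}|lborel. g r \<omega>) \<partial>M)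
       = (LINT r:{s..t}|lborel. (\<integral>\<omega>. \<xi> \<omega> * cnj (g r \<omega>) \<partial>M))"
    by (simp add: restr)
  have "norm (\<integral>r. (\<integral>\<omega>. \<xi> \<omega> * cnj (g r \<omega>) \<partial>M) \<partial>N) \<le> (\<integral>r. 2 * K \<partial>N)"
  proof (rule Bochner_Integration.integral_norm_bound_integral[OF int'])
    fix r assume "r \<in> space N"
    then show "norm (\<integral>\<omega>. \<xi> \<omega> * cnj (g r \<omega>) \<partial>M) \<le> 2 * K"
      using order_trans[OF integral_norm_bound bd] by (simp add: spN)
  qed simp
  then show "norm (\<integral>\<omega>. \<xi> \<omega> * cnj (LINT r:{s..t}|lborel. g r \<omega>) \<partial>M) \<le> 2 * K * (t - s)"
    using \<open>s \<le> t\<close> by (simp add: swap measure_def emN mult_ac)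
qed

text \<open>
  If \<open>dy/dt = g\<close>, then \<open>d/dt E \<bar>y\<bar>\<^sup>2 = 2 Re E (y g\<^sup>*)\<close>; a quantity that converges, and whose derivative
  converges, has a derivative that tends to \<open>0\<close>. The paths of \<open>y\<close> are only absolutely continuous, so the product rule is
  replaced by the difference identity
  \<open>\<bar>y(t)\<bar>\<^sup>2 - \<bar>y(T)\<bar>\<^sup>2 = Re ((y(t) + y(T)) (y(t) - y(T))\<^sup>*)\<close>. The increment is the integral of \<open>g\<close> over a window of
  length \<open>\<delta>\<close>, and within that window \<open>y(t)\<close> and \<open>y(T)\<close> may be exchanged for \<open>y(r)\<close> at a cost of order \<open>\<delta>\<close>. So
  \<open>E \<bar>y\<bar>\<^sup>2\<close> changes by \<open>2 \<delta> l\<close> up to an error of order \<open>\<delta>\<^sup>2\<close> and one that disappears as \<open>T\<close> grows, which is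
  incompatible with convergence unless \<open>l = 0\<close>.
\<close>

lemma (in prob_space) energy_drift_zero:
  fixes y g :: "real \<Rightarrow> 'a \<Rightarrow> complex"
  assumes g_meas: "(\<lambda>(r, \<omega>). g r \<omega>) \<in> borel_measurable (restrict_space lborel {0..} \<Otimes>\<^sub>M M)"
    and y_meas: "\<And>t. 0 \<le> t \<Longrightarrow> y t \<in> borel_measurable M"
    and ysq: "\<And>t. 0 \<le> t \<Longrightarrow> integrable M (\<lambda>\<omega>. (norm (y t \<omega>))\<^sup>2)"
    and gsq: "\<And>t. 0 \<le> t \<Longrightarrow> integrable M (\<lambda>\<omega>. (norm (g t \<omega>))\<^sup>2)"
    and bound: "\<forall>\<^sub>F t in at_top. (\<integral>\<omega>. (norm (y t \<omega>))\<^sup>2 \<partial>M) \<le> K \<and> (\<integral>\<omega>. (norm (g t \<omega>))\<^sup>2 \<partial>M) \<le> K"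
    and path: "AE \<omega> in M. \<forall>t\<ge>0. set_integrable lborel {0..t} (\<lambda>r. g r \<omega>) \<and>
        y t \<omega> = c \<omega> + (LINT r:{0..t}|lborel. g r \<omega>)"
    and lim_energy: "((\<lambda>t. \<integral>\<omega>. (norm (y t \<omega>))\<^sup>2 \<partial>M) \<longlongrightarrow> p) at_top"
    and lim_drift: "((\<lambda>t. Re (\<integral>\<omega>. y t \<omega> * cnj (g t \<omega>) \<partial>M)) \<longlongrightarrow> l) at_top"
  shows "l = 0"
proof (rule ccontr)
  assume "l \<noteq> 0"
  define K' where "K' = max K 1"
  \<comment> \<open>With this \<open>\<delta>\<close> the increments over the window contribute at most \<open>2 K' \<delta> = \<bar>l\<bar> / 4\<close> to a correlation.\<close>
  define \<delta> where "\<delta> = \<bar>l\<bar> / (8 * K')"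
  have "K' > 0" by (simp add: K'_def)
  with \<open>l \<noteq> 0\<close> have "\<delta> > 0" by (simp add: \<delta>_def)
  define E where "E t = (\<integral>\<omega>. (norm (y t \<omega>))\<^sup>2 \<partial>M)" for t
  have "((\<lambda>T. E (T + \<delta>) - E T) \<longlongrightarrow> p - p) at_top"
  proof (intro tendsto_diff)
    have "filterlim (\<lambda>T. T + \<delta>) at_top at_top"
      using filterlim_tendsto_add_at_top[OF tendsto_const[of \<delta>] filterlim_ident]
      by (simp add: add.commute)
    from filterlim_compose[OF lim_energy this] show "((\<lambda>T. E (T + \<delta>)) \<longlongrightarrow> p) at_top"
      by (simp add: E_def)
  qed (use lim_energy in \<open>simp add: E_def[abs_def]\<close>)
  then have ev1: "\<forall>\<^sub>F T in at_top. \<bar>E (T + \<delta>) - E T\<bar> < \<delta> * \<bar>l\<bar>"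
    using \<open>\<delta> > 0\<close> \<open>l \<noteq> 0\<close> by (auto dest!: tendstoD[where e = "\<delta> * \<bar>l\<bar>"] simp: dist_real_def)
  have ev2: "\<forall>\<^sub>F t in at_top. \<bar>Re (\<integral>\<omega>. y t \<omega> * cnj (g t \<omega>) \<partial>M) - l\<bar> < \<bar>l\<bar> / 4"
    using tendstoD[OF lim_drift, of "\<bar>l\<bar> / 4"] \<open>l \<noteq> 0\<close> by (simp add: dist_real_def)
  obtain T1 where T1: "\<And>t. t \<ge> T1 \<Longrightarrow> \<bar>E (t + \<delta>) - E t\<bar> < \<delta> * \<bar>l\<bar>"
    using ev1 by (auto simp: eventually_at_top_linorder)
  obtain T2 where T2: "\<And>t. t \<ge> T2 \<Longrightarrow> \<bar>Re (\<integral>\<omega>. y t \<omega> * cnj (g t \<omega>) \<partial>M) - l\<bar> < \<bar>l\<bar> / 4"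
    using ev2 by (auto simp: eventually_at_top_linorder)
  obtain T3 where T3: "\<And>t. t \<ge> T3 \<Longrightarrow> E t \<le> K \<and> (\<integral>\<omega>. (norm (g t \<omega>))\<^sup>2 \<partial>M) \<le> K"
    using bound by (auto simp: eventually_at_top_linorder E_def)
  define T where "T = Max {0, T1, T2, T3}"
  have T: "0 \<le> T" "T1 \<le> T" "T2 \<le> T" "T3 \<le> T" by (auto simp: T_def)
  define t where "t = T + \<delta>"
  have "T \<le> t" using \<open>\<delta> > 0\<close> by (simp add: t_def)
  have yK: "E r \<le> K'" and gK: "(\<integral>\<omega>. (norm (g r \<omega>))\<^sup>2 \<partial>M) \<le> K'" if "r \<ge> T" for r
    using T3[of r] that T by (auto simp: K'_def)
  have g_meas': "(\<lambda>(r, \<omega>). g r \<omega>) \<in> borel_measurable (restrict_space lborel {a..b} \<Otimes>\<^sub>M M)"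
    if "0 \<le> a" for a b
  proof -
    have "(\<lambda>q. (fst q, snd q)) \<in> restrict_space lborel {a..b} \<Otimes>\<^sub>M M \<rightarrow>\<^sub>M restrict_space lborel {0..} \<Otimes>\<^sub>M M"
    proof (rule measurable_Pair)
      have "(\<lambda>r. r) \<in> restrict_space lborel {a..b} \<rightarrow>\<^sub>M restrict_space lborel {0::real..}"
        using that by (intro measurable_restrict_space3) auto
      from measurable_compose[OF measurable_fst[of _ M] this]
      show "fst \<in> restrict_space lborel {a..b} \<Otimes>\<^sub>M M \<rightarrow>\<^sub>M restrict_space lborel {0..}" by simp
    qed simp
    from measurable_compose[OF this g_meas] show ?thesis by (simp add: split_beta')
  qed
  have g1: "g r \<in> borel_measurable M" if "0 \<le> r" for r
    using measurable_compose[OF measurable_Pair1' g_meas, of r] that by (simp add: space_restrict_space)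
  have incr: "AE \<omega> in M. y b \<omega> - y a \<omega> = (LINT r:{a..b}|lborel. g r \<omega>)" if "0 \<le> a" "a \<le> b" for a b
    using path
  proof eventually_elim
    case (elim \<omega>)
    have "set_integrable lborel {0..b} (\<lambda>r. g r \<omega>)" using elim that by auto
    then have "(LINT r:{0..a}|lborel. g r \<omega>) + (LINT r:{a..b}|lborel. g r \<omega>) = (LINT r:{0..b}|lborel. g r \<omega>)"
      using that AE_lborel_singleton[of a]
      by (subst set_integral_Un_AE[symmetric])
        (auto intro: set_integrable_subset simp: ivl_disj_un_two_touch)
    then show ?case using elim that by (simp add: algebra_simps)
  qed
  note corr = correlation_with_time_integral[where K = K', OF g_meas']
  have incr_corr: "(\<integral>\<omega>. \<xi> \<omega> * cnj (y b \<omega> - y a \<omega>) \<partial>M) = (\<integral>\<omega>. \<xi> \<omega> * cnj (LINT r:{a..b}|lborel. g r \<omega>) \<partial>M)"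
    if "T \<le> a" "a \<le> b" and \<xi>[measurable]: "\<xi> \<in> borel_measurable M" for a b and \<xi> :: "'a \<Rightarrow> complex"
  proof (rule integral_cong_AE)
    show "AE \<omega> in M. \<xi> \<omega> * cnj (y b \<omega> - y a \<omega>) = \<xi> \<omega> * cnj (LINT r:{a..b}|lborel. g r \<omega>)"
    proof -
      have "AE \<omega> in M. y b \<omega> - y a \<omega> = (LINT r:{a..b}|lborel. g r \<omega>)"
        using that T by (intro incr) auto
      then show ?thesis by eventually_elim simp
    qed
    show "(\<lambda>\<omega>. \<xi> \<omega> * cnj (y b \<omega> - y a \<omega>)) \<in> borel_measurable M"
      using y_meas[of a] y_meas[of b] that T by simp
    show "(\<lambda>\<omega>. \<xi> \<omega> * cnj (LINT r:{a..b}|lborel. g r \<omega>)) \<in> borel_measurable M"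
      using corr(1)[of a b "\<lambda>_. 0"] that T \<open>K' > 0\<close> gK gsq by simp
  qed
  have near: "norm (\<integral>\<omega>. (y b \<omega> - y a \<omega>) * cnj (g r \<omega>) \<partial>M) \<le> 2 * K' * \<delta>"
    if "T \<le> a" "a \<le> b" "b \<le> t" "r \<in> {T..t}" for a b r
  proof -
    have "(\<integral>\<omega>. (y b \<omega> - y a \<omega>) * cnj (g r \<omega>) \<partial>M) = cnj (\<integral>\<omega>. g r \<omega> * cnj (y b \<omega> - y a \<omega>) \<partial>M)"
      using Bochner_Integration.integral_cnj[of M "\<lambda>\<omega>. g r \<omega> * cnj (y b \<omega> - y a \<omega>)"] by (simp add: mult.commute)
    moreover have "norm (\<integral>\<omega>. g r \<omega> * cnj (y b \<omega> - y a \<omega>) \<partial>M) \<le> 2 * K' * (b - a)"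
      using that T by (subst incr_corr) (auto intro!: corr(4) gsq gK g1)
    moreover have "2 * K' * (b - a) \<le> 2 * K' * \<delta>"
      using that \<open>K' > 0\<close> by (simp add: t_def)
    ultimately show ?thesis by simp
  qed
  \<comment> \<open>Each endpoint contributes half of the change of the energy.\<close>
  have half: "\<bar>Re (\<integral>\<omega>. y a \<omega> * cnj (y t \<omega> - y T \<omega>) \<partial>M) - \<delta> * l\<bar> \<le> \<delta> * (\<bar>l\<bar> / 2)"
    if a: "a = T \<or> a = t" for a
  proof -
    have a': "0 \<le> a" "T \<le> a" using a T \<open>T \<le> t\<close> by auto
    define h where "h r = (\<integral>\<omega>. y a \<omega> * cnj (g r \<omega>) \<partial>M)" for r
    have h_near: "\<bar>Re (h r) - l\<bar> \<le> \<bar>l\<bar> / 2" if r: "r \<in> {T..t}" for r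
    proof -
      have i: "integrable M (\<lambda>\<omega>. y b \<omega> * cnj (g r \<omega>))" if "0 \<le> b" for b
        using that r T by (intro integrable_mult_cnj y_meas g1 ysq gsq) auto
      have split: "h r = (\<integral>\<omega>. y r \<omega> * cnj (g r \<omega>) \<partial>M) + (\<integral>\<omega>. (y a \<omega> - y r \<omega>) * cnj (g r \<omega>) \<partial>M)"
        unfolding h_def
        using i[of a] i[of r] a' r T by (subst Bochner_Integration.integral_add[symmetric]) (auto simp: algebra_simps)
      have n1: "\<bar>Re (\<integral>\<omega>. y r \<omega> * cnj (g r \<omega>) \<partial>M) - l\<bar> < \<bar>l\<bar> / 4"
        using T2[of r] r T by simp
      have n2: "norm (\<integral>\<omega>. (y a \<omega> - y r \<omega>) * cnj (g r \<omega>) \<partial>M) \<le> 2 * K' * \<delta>"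
      proof (cases "a = t")
        case True
        then show ?thesis using near[of r t r] r by simp
      next
        case False
        then have "a = T" using a by simp
        have "(\<integral>\<omega>. (y T \<omega> - y r \<omega>) * cnj (g r \<omega>) \<partial>M) = - (\<integral>\<omega>. (y r \<omega> - y T \<omega>) * cnj (g r \<omega>) \<partial>M)"
          by (subst Bochner_Integration.integral_minus[symmetric]) (simp add: algebra_simps)
        then show ?thesis using near[of T r r] r \<open>a = T\<close> by simp
      qed
      have n3: "2 * K' * \<delta> = \<bar>l\<bar> / 4" using \<open>K' > 0\<close> by (simp add: \<delta>_def)
      have "\<bar>Re (u + v) - l\<bar> \<le> \<bar>Re u - l\<bar> + norm v" for u v
        using abs_Re_le_cmod[of v] by simp
      then have "\<bar>Re (h r) - l\<bar> \<le> \<bar>Re (\<integral>\<omega>. y r \<omega> * cnj (g r \<omega>) \<partial>M) - l\<bar>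
          + norm (\<integral>\<omega>. (y a \<omega> - y r \<omega>) * cnj (g r \<omega>) \<partial>M)"
        unfolding split .
      also have "\<dots> \<le> \<bar>l\<bar> / 4 + \<bar>l\<bar> / 4"
        using n1 n2 n3 by (intro add_mono) auto
      finally show ?thesis by simp
    qed
    have c1: "set_integrable lborel {T..t} h"
      using T \<open>T \<le> t\<close> a' yK[of a] unfolding h_def
      by (intro corr(2)) (auto intro!: gsq gK ysq y_meas simp: E_def)
    have c2: "(\<integral>\<omega>. y a \<omega> * cnj (y t \<omega> - y T \<omega>) \<partial>M) = (LINT r:{T..t}|lborel. h r)"
      unfolding h_def using T \<open>T \<le> t\<close> a' yK[of a]
      by (subst incr_corr[OF _ _ y_meas], simp, simp, simp, intro corr(3))
        (auto intro!: gsq gK ysq y_meas simp: E_def)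
    have ri: "set_integrable lborel {T..t} (\<lambda>r. Re (h r))"
      using integrable_Re[OF c1[unfolded set_integrable_def]] by (simp add: set_integrable_def)
    have ci: "set_integrable lborel {T..t} (\<lambda>r. k)"
        "(LINT r:{T..t}|lborel. k) = \<delta> * k" for k :: real
      using \<open>T \<le> t\<close> by (auto simp: set_integrable_def set_integral_const t_def)
    have "Re (LINT r:{T..t}|lborel. h r) = (LINT r:{T..t}|lborel. Re (h r))"
      using integral_Re[OF c1[unfolded set_integrable_def]] by (simp add: set_lebesgue_integral_def)
    moreover have "(LINT r:{T..t}|lborel. Re (h r)) - \<delta> * l = (LINT r:{T..t}|lborel. Re (h r) - l)"
      using ri ci by simp
    moreover have "\<bar>LINT r:{T..t}|lborel. Re (h r) - l\<bar> \<le> \<delta> * (\<bar>l\<bar> / 2)"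
    proof -
      have "norm (LINT r:{T..t}|lborel. Re (h r) - l) \<le> (LINT r:{T..t}|lborel. norm (Re (h r) - l))"
        by (intro set_integral_norm_bound set_integral_diff ri ci)
      also have "\<dots> \<le> (LINT r:{T..t}|lborel. \<bar>l\<bar> / 2)"
        using h_near by (intro set_integral_mono set_integrable_norm set_integral_diff ri ci) auto
      finally show ?thesis by (simp add: ci)
    qed
    ultimately show ?thesis using c2 by simp
  qed
  \<comment> \<open>The mixed terms are conjugate to each other, so their real parts cancel.\<close>
  have "E t - E T = Re (\<integral>\<omega>. y t \<omega> * cnj (y t \<omega> - y T \<omega>) \<partial>M) + Re (\<integral>\<omega>. y T \<omega> * cnj (y t \<omega> - y T \<omega>) \<partial>M)"
  proof -
    have i: "integrable M (\<lambda>\<omega>. y a \<omega> * cnj (y b \<omega>))" if "0 \<le> a" "0 \<le> b" for a b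
      using that by (intro integrable_mult_cnj y_meas ysq)
    have t0: "0 \<le> t" using T \<open>T \<le> t\<close> by simp
    have E': "E a = Re (\<integral>\<omega>. y a \<omega> * cnj (y a \<omega>) \<partial>M)" if "0 \<le> a" for a
      using integral_Re[OF i[OF that that]] by (simp add: E_def complex_mult_cnj cmod_power2)
    have "(\<integral>\<omega>. y T \<omega> * cnj (y t \<omega>) \<partial>M) = cnj (\<integral>\<omega>. y t \<omega> * cnj (y T \<omega>) \<partial>M)"
      using Bochner_Integration.integral_cnj[of M "\<lambda>\<omega>. y t \<omega> * cnj (y T \<omega>)"] by (simp add: mult.commute)
    then show ?thesis
      using i T t0 by (simp add: E' right_diff_distrib)
  qed
  then have "E t - E T - 2 * (\<delta> * l) = (Re (\<integral>\<omega>. y t \<omega> * cnj (y t \<omega> - y T \<omega>) \<partial>M) - \<delta> * l)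
      + (Re (\<integral>\<omega>. y T \<omega> * cnj (y t \<omega> - y T \<omega>) \<partial>M) - \<delta> * l)"
    by simp
  then have "\<bar>E t - E T - 2 * (\<delta> * l)\<bar> \<le> \<delta> * (\<bar>l\<bar> / 2) + \<delta> * (\<bar>l\<bar> / 2)"
    using order_trans[OF abs_triangle_ineq add_mono[OF half[of t] half[of T]]] by simp
  then have "\<bar>E t - E T - 2 * (\<delta> * l)\<bar> \<le> \<delta> * \<bar>l\<bar>" by simp
  moreover have "\<bar>E t - E T\<bar> < \<delta> * \<bar>l\<bar>" using T1[of T] T by (simp add: t_def)
  moreover have "\<bar>2 * (\<delta> * l)\<bar> = 2 * (\<delta> * \<bar>l\<bar>)" using \<open>\<delta> > 0\<close> by (simp add: abs_mult)
  ultimately show False by linarith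
qed

section \<open>Directions that the noise does not reach\<close>

text \<open>
  A vector \<open>v\<close> with \<open>B\<^sup>* v = 0\<close> does not see the noise: the scalar process \<open>y = v\<^sup>* x\<close> satisfies
  \<open>dy/dt = v\<^sup>* A x\<close> without input term. Its mean square converges to \<open>v\<^sup>* X v\<close>, so in the limit its rate of change, which is
  \<open>v\<^sup>* (A X + X A\<^sup>*) v\<close>, must vanish. This is the part of the representation \<open>Z = B H\<^sup>* + H B\<^sup>*\<close> that the bounds
  by the number of inputs require.
\<close>

lemma steady_state_form_zero:
  fixes A X Z :: "complex^'n^'n" and B :: "complex^'m^'n"
    and U :: "real \<Rightarrow> 'w \<Rightarrow> complex^'m" and x :: "real \<Rightarrow> 'w \<Rightarrow> complex^'n"
  assumes "prob_space M"
    and state: "state_process M A B U x"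
    and cov: "steady_state_covariance M x X"
    and X: "hermitian_mat X"
    and lyap: "A ** X + X ** adjoint_mat A = - Z"
    and v: "adjoint_mat B *v v = 0"
  shows "Re (cip v (Z *v v)) = 0"
proof -
  interpret prob_space M by fact
  define w where "w = adjoint_mat A *v v"
  have x_meas: "(\<lambda>(t, \<omega>). x t \<omega>) \<in> borel_measurable (restrict_space lborel {0..} \<Otimes>\<^sub>M M)"
    and x_sq: "\<And>t. 0 \<le> t \<Longrightarrow> integrable M (\<lambda>\<omega>. (norm (x t \<omega>))\<^sup>2)"
    and x_path: "AE \<omega> in M. \<forall>t\<ge>0. set_integrable lborel {0..t} (\<lambda>s. x s \<omega>) \<and>
        x t \<omega> = x 0 \<omega> + A *v (LINT s:{0..t}|lborel. x s \<omega>) + B *v U t \<omega>"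
    using state by (auto simp: state_process_def)
  have x1: "x t \<in> borel_measurable M" if "0 \<le> t" for t
    using measurable_compose[OF measurable_Pair1' x_meas, of t] that by (simp add: space_restrict_space)
  have cip_meas [measurable]: "cip a \<in> borel_measurable borel" for a :: "complex^'n"
    by (intro borel_measurable_continuous_onI linear_continuous_on bounded_linear_cip)
  have xx: "integrable M (\<lambda>\<omega>. outer (x t \<omega>) (x t \<omega>))" if "0 \<le> t" for t
    by (intro outer_integrable x1 x_sq that)
  have corr: "integrable M (\<lambda>\<omega>. cip a (x t \<omega>) * cnj (cip b (x t \<omega>)))"
    "(\<integral>\<omega>. cip a (x t \<omega>) * cnj (cip b (x t \<omega>)) \<partial>M) = cip a ((\<integral>\<omega>. outer (x t \<omega>) (x t \<omega>) \<partial>M) *v b)"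
    if "0 \<le> t" for a b t
    unfolding cip_mult_cnj_cip
    using integrable_bounded_linear[OF bounded_linear_cip_matrix xx[OF that]]
      integral_bounded_linear[OF bounded_linear_cip_matrix xx[OF that]] by auto
  have corr_lim: "((\<lambda>t. \<integral>\<omega>. cip a (x t \<omega>) * cnj (cip b (x t \<omega>)) \<partial>M) \<longlongrightarrow> cip a (X *v b)) at_top" for a b
  proof (rule Lim_transform_eventually)
    show "((\<lambda>t. cip a ((\<integral>\<omega>. outer (x t \<omega>) (x t \<omega>) \<partial>M) *v b)) \<longlongrightarrow> cip a (X *v b)) at_top"
      using cov unfolding steady_state_covariance_def
      by (rule bounded_linear.tendsto[OF bounded_linear_cip_matrix])
    show "\<forall>\<^sub>F t in at_top. cip a ((\<integral>\<omega>. outer (x t \<omega>) (x t \<omega>) \<partial>M) *v b)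
        = (\<integral>\<omega>. cip a (x t \<omega>) * cnj (cip b (x t \<omega>)) \<partial>M)"
      using eventually_ge_at_top[of 0] by eventually_elim (simp add: corr(2))
  qed
  have norm_sq: "(norm z)\<^sup>2 = Re (z * cnj z)" for z :: complex
    by (simp add: complex_mult_cnj cmod_power2)
  have sq: "integrable M (\<lambda>\<omega>. (norm (cip a (x t \<omega>)))\<^sup>2)"
    "(\<integral>\<omega>. (norm (cip a (x t \<omega>)))\<^sup>2 \<partial>M) = Re (\<integral>\<omega>. cip a (x t \<omega>) * cnj (cip a (x t \<omega>)) \<partial>M)"
    if "0 \<le> t" for a t
    unfolding norm_sq by (rule integrable_Re integral_Re corr(1) that)+
  have sq_lim: "((\<lambda>t. \<integral>\<omega>. (norm (cip a (x t \<omega>)))\<^sup>2 \<partial>M) \<longlongrightarrow> Re (cip a (X *v a))) at_top" for a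
  proof (rule Lim_transform_eventually)
    show "((\<lambda>t. Re (\<integral>\<omega>. cip a (x t \<omega>) * cnj (cip a (x t \<omega>)) \<partial>M)) \<longlongrightarrow> Re (cip a (X *v a))) at_top"
      by (intro tendsto_Re corr_lim)
    show "\<forall>\<^sub>F t in at_top. Re (\<integral>\<omega>. cip a (x t \<omega>) * cnj (cip a (x t \<omega>)) \<partial>M)
        = (\<integral>\<omega>. (norm (cip a (x t \<omega>)))\<^sup>2 \<partial>M)"
      using eventually_ge_at_top[of 0] by eventually_elim (simp add: sq(2))
  qed
  define K where "K = max (Re (cip v (X *v v))) (Re (cip w (X *v w))) + 1"
  have "Re (cip v (X *v w)) = 0"
  proof (rule energy_drift_zero)
    show "(\<lambda>(t, \<omega>). cip w (x t \<omega>)) \<in> borel_measurable (restrict_space lborel {0..} \<Otimes>\<^sub>M M)"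
      using measurable_compose[OF x_meas cip_meas] by (simp add: split_beta')
    show "(\<lambda>\<omega>. cip v (x t \<omega>)) \<in> borel_measurable M" if "0 \<le> t" for t
      using measurable_compose[OF x1[OF that] cip_meas] .
    show "integrable M (\<lambda>\<omega>. (norm (cip v (x t \<omega>)))\<^sup>2)" "integrable M (\<lambda>\<omega>. (norm (cip w (x t \<omega>)))\<^sup>2)"
      if "0 \<le> t" for t using sq(1)[OF that] by auto
    show "\<forall>\<^sub>F t in at_top. (\<integral>\<omega>. (norm (cip v (x t \<omega>)))\<^sup>2 \<partial>M) \<le> K \<and>
        (\<integral>\<omega>. (norm (cip w (x t \<omega>)))\<^sup>2 \<partial>M) \<le> K"
    proof -
      have "Re (cip v (X *v v)) < K" "Re (cip w (X *v w)) < K" by (auto simp: K_def)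
      from order_tendstoD(2)[OF sq_lim this(1)] order_tendstoD(2)[OF sq_lim this(2)] show ?thesis
        by eventually_elim simp
    qed
    show "AE \<omega> in M. \<forall>t\<ge>0. set_integrable lborel {0..t} (\<lambda>r. cip w (x r \<omega>)) \<and>
        cip v (x t \<omega>) = cip v (x 0 \<omega>) + (LINT r:{0..t}|lborel. cip w (x r \<omega>))"
      using x_path
    proof (eventually_elim, intro allI impI)
      fix \<omega> and t :: real
      assume *: "\<forall>t\<ge>0. set_integrable lborel {0..t} (\<lambda>s. x s \<omega>) \<and>
          x t \<omega> = x 0 \<omega> + A *v (LINT s:{0..t}|lborel. x s \<omega>) + B *v U t \<omega>" and "0 \<le> t"
      then have si: "integrable lborel (\<lambda>s. indicator {0..t} s *\<^sub>R x s \<omega>)"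
        by (auto simp: set_integrable_def)
      have "x t \<omega> = x 0 \<omega> + A *v (LINT s:{0..t}|lborel. x s \<omega>) + B *v U t \<omega>"
        using *[rule_format, OF \<open>0 \<le> t\<close>] by blast
      then have "cip v (x t \<omega>) = cip v (x 0 \<omega>) + cip w (LINT s:{0..t}|lborel. x s \<omega>)"
        by (simp only: cip_add_right cip_adjoint v cip_zero_left w_def add_0_right)
      then show "set_integrable lborel {0..t} (\<lambda>r. cip w (x r \<omega>)) \<and>
          cip v (x t \<omega>) = cip v (x 0 \<omega>) + (LINT r:{0..t}|lborel. cip w (x r \<omega>))"
        using integrable_bounded_linear[OF bounded_linear_cip si, of w]
          integral_bounded_linear[OF bounded_linear_cip si, of w]
        by (simp add: set_integrable_def set_lebesgue_integral_def cip_scaleR_right)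
    qed
    show "((\<lambda>t. \<integral>\<omega>. (norm (cip v (x t \<omega>)))\<^sup>2 \<partial>M) \<longlongrightarrow> Re (cip v (X *v v))) at_top"
      by (rule sq_lim)
    show "((\<lambda>t. Re (\<integral>\<omega>. cip v (x t \<omega>) * cnj (cip w (x t \<omega>)) \<partial>M)) \<longlongrightarrow> Re (cip v (X *v w))) at_top"
      by (intro tendsto_Re corr_lim)
  qed
  moreover have "cip v (A *v (X *v v)) = cnj (cip v (X *v w))"
    using X by (simp add: hermitian_mat_def cip_adjoint[of v A] cip_adjoint[of v X] w_def[symmetric] cip_commute[of w])
  ultimately show ?thesis
    by (simp add: lyapunov_form[OF X lyap])
qed

section \<open>The spectral theorem for Hermitian matrices\<close>

text \<open>
  A maximizer \<open>w\<close> of the Rayleigh quotient over \<open>W\<close> is an eigenvector: perturbing it by a small multiple of the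
  residual \<open>u = Z w - l w\<close>, which again lies in \<open>W\<close>, would otherwise increase the quotient to first order.
\<close>

lemma rayleigh_eigenvector:
  fixes Z :: "complex^'n^'n"
  assumes Z: "hermitian_mat Z"
    and W: "vec.subspace W" "closed W" and inv: "\<And>v. v \<in> W \<Longrightarrow> Z *v v \<in> W"
    and w0: "w0 \<in> W" "w0 \<noteq> 0"
  obtains w and l :: real where "w \<in> W" "norm w = 1" "Z *v w = of_real l *s w"
proof -
  have real_scale: "of_real r *s v = r *\<^sub>R v" for r and v :: "complex^'n"
    by (simp add: vec_eq_iff scaleR_conv_of_real[where 'a = complex])
  \<comment> \<open>As a real Euclidean space, \<open>W\<close> has the real part of the Hermitian form as inner product, for which \<open>Z\<close> is symmetric.\<close>
  have sub: "subspace W"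
    using W(1) unfolding subspace_def vec.subspace_def by (metis real_scale)
  have sym: "(Z *v v) \<bullet> u = v \<bullet> (Z *v u)" for u v
    using cip_adjoint[of v Z u] Z by (simp add: Re_cip[symmetric] hermitian_mat_def)
  interpret bl: bounded_linear "(*v) Z" by (rule matrix_vector_mul_bounded_linear)
  define q where "q v = v \<bullet> (Z *v v)" for v
  have "compact (W \<inter> sphere 0 1)"
    using W(2) by (simp add: compact_Int closed_Int_compact)
  moreover have "(1 / norm w0) *\<^sub>R w0 \<in> W \<inter> sphere 0 1"
    using w0 sub by (auto simp: subspace_scale)
  then have "W \<inter> sphere 0 1 \<noteq> {}" by blast
  moreover have "continuous_on (W \<inter> sphere 0 1) q"
    unfolding q_def by (intro continuous_intros bl.continuous_on)
  ultimately obtain w where w: "w \<in> W \<inter> sphere 0 1" and max: "\<And>v. v \<in> W \<inter> sphere 0 1 \<Longrightarrow> q v \<le> q w"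
    using continuous_attains_sup[of "W \<inter> sphere 0 1" q] by blast
  define l where "l = q w"
  have nw: "norm w = 1" and wW: "w \<in> W" using w by auto
  have le: "q v \<le> l * (norm v)\<^sup>2" if "v \<in> W" for v
  proof (cases "v = 0")
    case False
    have "q ((1 / norm v) *\<^sub>R v) \<le> l"
      unfolding l_def using that False sub by (intro max) (auto simp: subspace_scale)
    moreover have "q ((1 / norm v) *\<^sub>R v) = q v / (norm v)\<^sup>2"
      by (simp add: q_def bl.scaleR power2_eq_square)
    ultimately show ?thesis using False by (simp add: divide_le_eq)
  qed (simp add: q_def)
  define u where "u = Z *v w - l *\<^sub>R w"
  have uW: "u \<in> W" unfolding u_def using sub wW inv by (intro subspace_diff subspace_scale) auto
  define C where "C = l * (norm u)\<^sup>2 - q u"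
  \<comment> \<open>Compare the quotient at \<open>w + t u\<close> with its maximum and divide by \<open>t\<close>; letting \<open>t\<close> tend to \<open>0\<close> forces \<open>u = 0\<close>.\<close>
  have bound: "2 * (norm u)\<^sup>2 \<le> t * C" if "t > 0" for t
  proof -
    have "q (w + t *\<^sub>R u) \<le> l * (norm (w + t *\<^sub>R u))\<^sup>2"
      using sub wW uW by (intro le subspace_add subspace_scale)
    moreover have "q (w + t *\<^sub>R u) = l + 2 * t * (u \<bullet> (Z *v w)) + t * t * q u"
      using sym[of w u] by (simp add: q_def l_def bl.add bl.scaleR inner_simps algebra_simps inner_commute)
    moreover have "(norm (w + t *\<^sub>R u))\<^sup>2 = 1 + 2 * t * (u \<bullet> w) + t * t * (norm u)\<^sup>2"
      using nw by (simp add: power2_norm_eq_inner inner_simps algebra_simps inner_commute norm_eq_1)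
    ultimately have "l + 2 * t * (u \<bullet> (Z *v w)) + t * t * q u \<le> l * (1 + 2 * t * (u \<bullet> w) + t * t * (norm u)\<^sup>2)"
      by simp
    then have "t * (2 * (u \<bullet> (Z *v w) - l * (u \<bullet> w))) \<le> t * (t * C)"
      by (simp add: C_def algebra_simps)
    moreover have "(norm u)\<^sup>2 = u \<bullet> (Z *v w) - l * (u \<bullet> w)"
      unfolding power2_norm_eq_inner by (subst (2) u_def) (simp add: inner_simps)
    ultimately have "t * (2 * (norm u)\<^sup>2) \<le> t * (t * C)" by (simp only:)
    then show ?thesis by (rule mult_left_le_imp_le) (rule that)
  qed
  have "u = 0"
  proof (rule ccontr)
    assume "u \<noteq> 0"
    then have n: "(norm u)\<^sup>2 > 0" by simp
    moreover have "2 * (norm u)\<^sup>2 \<le> C" using bound[of 1] by simp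
    ultimately have "C > 0" by linarith
    then have "(norm u)\<^sup>2 / C * C = (norm u)\<^sup>2" "(norm u)\<^sup>2 / C > 0" using n by auto
    with bound[OF this(2)] n show False by simp
  qed
  then have "Z *v w = of_real l *s w" by (simp add: u_def real_scale)
  with nw wW show ?thesis using that by blast
qed

text \<open>
  The family is built up one index at a time. As long as an index is missing, the eigenvectors found
  so far cannot detect all vectors, so their orthogonal complement is nonzero; it is closed and invariant under \<open>Z\<close>, and
  thus contains a further eigenvector.
\<close>

lemma hermitian_orthonormal_eigenvectors:
  fixes Z :: "complex^'n^'n"
  assumes Z: "hermitian_mat Z"
  obtains e :: "'n \<Rightarrow> complex^'n" and d :: "'n \<Rightarrow> real"
  where "\<And>i j. cip (e i) (e j) = (if i = j then 1 else 0)" "\<And>i. Z *v e i = of_real (d i) *s e i"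
proof -
  have "\<exists>(e :: 'n \<Rightarrow> complex^'n) (d :: 'n \<Rightarrow> real). (\<forall>i\<in>I. \<forall>j\<in>I. cip (e i) (e j) = (if i = j then 1 else 0)) \<and>
      (\<forall>i\<in>I. Z *v e i = of_real (d i) *s e i)" if "finite I" for I :: "'n set"
    using that
  proof induction
    case (insert k I)
    then obtain e :: "'n \<Rightarrow> complex^'n" and d :: "'n \<Rightarrow> real"
      where e: "\<And>i j. i \<in> I \<Longrightarrow> j \<in> I \<Longrightarrow> cip (e i) (e j) = (if i = j then 1 else 0)"
        and d: "\<And>i. i \<in> I \<Longrightarrow> Z *v e i = of_real (d i) *s e i" by blast
    define f :: "complex^'n \<Rightarrow> complex^'n" where "f w = (\<chi> i. if i \<in> I then cip (e i) w else 0)" for w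
    have lin: "Vector_Spaces.linear (*s) (*s) f"
      by unfold_locales (auto simp: f_def vec_eq_iff cip_add_right cip_scale_right)
    define W where "W = {w. \<forall>i\<in>I. cip (e i) w = 0}"
    have sub: "vec.subspace W"
      by (auto simp: W_def vec.subspace_def cip_zero_right cip_add_right cip_scale_right)
    have "\<exists>w\<in>W. w \<noteq> 0"
    proof (rule ccontr)
      assume *: "\<not> (\<exists>w\<in>W. w \<noteq> 0)"
      have "vec.dim (UNIV :: (complex^'n) set) \<le> vec.dim {x::complex^'n. \<forall>i. i \<notin> I \<longrightarrow> x $ i = 0}"
      proof (rule dim_le_if_injective[OF vec.subspace_UNIV lin])
        fix v assume "f v = 0"
        then have "v \<in> W" unfolding W_def f_def vec_eq_iff by (auto split: if_splits)
        then show "v = 0" using * by blast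
      qed (auto simp: f_def)
      then have "card (UNIV :: 'n set) \<le> card I"
        by (simp add: dim_substandard_cart vec.dim_UNIV card_cart_basis)
      moreover have "card I < card (UNIV :: 'n set)"
        using \<open>k \<notin> I\<close> by (intro psubset_card_mono) auto
      ultimately show False by simp
    qed
    then obtain w0 where w0: "w0 \<in> W" "w0 \<noteq> 0" by blast
    have "closed W"
    proof -
      have "W = (\<Inter>i\<in>I. {w. cip (e i) w = 0})" by (auto simp: W_def)
      moreover have "closed {w. cip (e i) w = 0}" for i
        by (intro closed_Collect_eq continuous_intros linear_continuous_on bounded_linear_cip)
      ultimately show ?thesis by auto
    qed
    moreover have "Z *v v \<in> W" if "v \<in> W" for v
      using that Z d by (auto simp: W_def cip_adjoint hermitian_mat_def cip_scale_left)
    ultimately obtain w and l :: real where w: "w \<in> W" "norm w = 1" "Z *v w = of_real l *s w"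
      using rayleigh_eigenvector[OF Z sub _ _ w0] by blast
    have "cip (e i) w = 0" "cip w (e i) = 0" if "i \<in> I" for i
      using w(1) that cip_commute[of w "e i"] by (auto simp: W_def)
    moreover have "cip w w = 1" using w(2) by (simp add: cip_self)
    ultimately show ?case
      using e d w insert.hyps
      by (intro exI[of _ "e(k := w)"] exI[of _ "d(k := l)"]) auto
  qed simp
  from this[OF finite[of UNIV]] obtain e :: "'n \<Rightarrow> complex^'n" and d :: "'n \<Rightarrow> real"
    where "\<forall>i\<in>UNIV. \<forall>j\<in>UNIV. cip (e i) (e j) = (if i = j then 1 else 0)"
      "\<forall>i\<in>UNIV. Z *v e i = of_real (d i) *s e i" by (elim exE conjE)
  then show ?thesis by (intro that[of e d]) simp_all
qed

lemma orthonormal_columns_unitary: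
  fixes e :: "'n \<Rightarrow> complex^'n" and Q :: "complex^'n^'n"
  assumes "\<And>i j. cip (e i) (e j) = (if i = j then 1 else 0)" and "Q = (\<chi> i j. e j $ i)"
  shows "adjoint_mat Q ** Q = mat 1"
  using assms by (simp add: adjoint_mat_def matrix_matrix_mult_def mat_def vec_eq_iff cip_def)

lemma orthonormal_expansion:
  fixes e :: "'n \<Rightarrow> complex^'n"
  assumes e: "\<And>i j. cip (e i) (e j) = (if i = j then 1 else 0)"
  shows "(\<Sum>i\<in>UNIV. cip (e i) v *s e i) = v"
proof -
  define Q :: "complex^'n^'n" where "Q = (\<chi> i j. e j $ i)"
  have "adjoint_mat Q ** Q = mat 1"
    by (rule orthonormal_columns_unitary[OF e Q_def])
  then have "Q ** adjoint_mat Q = mat 1" by (simp add: matrix_left_right_inverse)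
  then have "v = Q *v (adjoint_mat Q *v v)" by (simp add: matrix_vector_mul_assoc)
  also have "\<dots> = (\<Sum>i\<in>UNIV. cip (e i) v *s e i)"
    by (simp add: Q_def adjoint_mat_def matrix_vector_mult_def vec_eq_iff cip_def mult.commute)
  finally show ?thesis by simp
qed

lemma cip_orthonormal_sum:
  fixes e :: "'n \<Rightarrow> complex^'n"
  assumes e: "\<And>i j. cip (e i) (e j) = (if i = j then 1 else 0)"
  shows "cip (e k) (\<Sum>i\<in>UNIV. c i *s e i) = c k"
proof -
  have "cip (e k) (\<Sum>i\<in>UNIV. c i *s e i) = (\<Sum>i\<in>UNIV. cip (e k) (c i *s e i))"
    by (rule linear_sum[OF bounded_linear.linear[OF bounded_linear_cip]])
  then show ?thesis by (simp add: cip_scale_right e mult_delta_right)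
qed

lemma form_diagonalized:
  fixes Z :: "complex^'n^'n" and e :: "'n \<Rightarrow> complex^'n" and d :: "'n \<Rightarrow> real"
  assumes e: "\<And>i j. cip (e i) (e j) = (if i = j then 1 else 0)"
    and d: "\<And>i. Z *v e i = of_real (d i) *s e i"
  shows "Re (cip v (Z *v v)) = (\<Sum>i\<in>UNIV. d i * (norm (cip (e i) v))\<^sup>2)"
proof -
  have "Z *v v = Z *v (\<Sum>i\<in>UNIV. cip (e i) v *s e i)"
    by (simp add: orthonormal_expansion[OF e])
  also have "\<dots> = (\<Sum>i\<in>UNIV. (cip (e i) v * of_real (d i)) *s e i)"
    by (simp add: vec.sum vec.scale d)
  finally have "cip v (Z *v v) = (\<Sum>i\<in>UNIV. cip v ((cip (e i) v * of_real (d i)) *s e i))"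
    by (simp add: linear_sum[OF bounded_linear.linear[OF bounded_linear_cip]])
  also have "\<dots> = (\<Sum>i\<in>UNIV. of_real (d i * (norm (cip (e i) v))\<^sup>2))"
  proof (rule sum.cong[OF refl])
    fix i
    show "cip v ((cip (e i) v * of_real (d i)) *s e i) = of_real (d i * (norm (cip (e i) v))\<^sup>2)"
      using complex_norm_square[of "cip (e i) v"] cip_commute[of v "e i"]
      by (simp add: cip_scale_right mult_ac)
  qed
  finally show ?thesis by simp
qed

section \<open>The characteristic polynomial\<close>

lemma poly_charpoly: "poly (charpoly A) z = det (\<chi> i j. (if i = j then z else 0) - A $ i $ j)"
  by (simp add: charpoly_def det_def poly_sum poly_prod if_distrib[of "\<lambda>p. poly p z"] cong: if_cong)

lemma eigenval_iff_root: "eigenval A z \<longleftrightarrow> poly (charpoly A) z = 0"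
proof -
  define N where "N = (\<chi> i j. (if i = j then z else 0) - A $ i $ j)"
  have "N *v v = z *s v - A *v v" for v
    by (simp add: N_def vec_eq_iff matrix_vector_mult_def algebra_simps sum_subtractf mult_delta_left mult_delta_right)
  then have "eigenval A z \<longleftrightarrow> (\<exists>v. v \<noteq> 0 \<and> N *v v = 0)"
    by (auto simp: eigenval_def)
  also have "\<dots> \<longleftrightarrow> \<not> invertible N"
    unfolding invertible_left_inverse matrix_left_invertible_ker by auto
  also have "\<dots> \<longleftrightarrow> poly (charpoly A) z = 0"
    by (simp add: invertible_det_nz poly_charpoly N_def)
  finally show ?thesis .
qed

text \<open>
  For \<open>w \<noteq> 0\<close> the determinant of \<open>1 - w A\<close> is \<open>w\<^sup>n\<close> times the characteristic polynomial at
  \<open>1 / w\<close>. If the latter were constant, this would tend to \<open>0\<close> as \<open>w \<rightarrow> 0\<close>, whereas by continuity it tends to \<open>det 1 = 1\<close>.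
  The argument avoids computing the degree.
\<close>

lemma charpoly_not_constant: "degree (charpoly (A :: complex^'n^'n)) \<noteq> 0"
proof
  assume "degree (charpoly A) = 0"
  then obtain c where c: "charpoly A = [:c:]" by (metis degree_eq_zeroE)
  define N where "N w = (\<chi> i j. (if i = j then 1 else 0) - w * A $ i $ j)" for w
  have N: "det (N w) = w ^ CARD('n) * c" if "w \<noteq> 0" for w
  proof -
    have "N w = (\<chi> i. w *s (\<chi> i j. (if i = j then 1 / w else 0) - A $ i $ j) $ i)"
      using that by (auto simp: N_def vec_eq_iff algebra_simps)
    then have "det (N w) = w ^ CARD('n) * poly (charpoly A) (1 / w)"
      by (simp add: det_rows_mul poly_charpoly)
    then show ?thesis by (simp add: c)
  qed
  have "(\<lambda>w. det (N w)) \<midarrow>0\<rightarrow> det (N 0)"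
    unfolding det_def N_def by (auto intro!: tendsto_eq_intros)
  moreover have "det (N 0) = 1"
  proof -
    have "N 0 = mat 1" by (simp add: N_def mat_def vec_eq_iff)
    then show ?thesis by simp
  qed
  moreover have "(\<lambda>w. det (N w)) \<midarrow>0\<rightarrow> 0"
  proof (rule Lim_transform_eventually)
    show "(\<lambda>w. w ^ CARD('n) * c) \<midarrow>0\<rightarrow> 0"
      by (auto intro!: tendsto_eq_intros)
    show "\<forall>\<^sub>F w in at 0. w ^ CARD('n) * c = det (N w)"
      by (auto simp: eventually_at_filter N)
  qed
  ultimately show False using LIM_unique by fastforce
qed

lemma finite_eigenvals: "finite {z. eigenval A z}"
  using charpoly_not_constant[of A] unfolding eigenval_iff_root
  by (intro poly_roots_finite) auto

lemma eigenval_exists: "\<exists>z. eigenval A z"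
  using charpoly_not_constant[of A] unfolding eigenval_iff_root
  by (intro fundamental_theorem_of_algebra) (simp add: constant_degree)

text \<open>
  The eigenvectors are the columns of a matrix \<open>Q\<close> with \<open>(z - Z) Q = Q (z - D)\<close>, and \<open>det Q \<noteq> 0\<close> cancels.
\<close>

lemma charpoly_diagonalized:
  fixes Z :: "complex^'n^'n" and e :: "'n \<Rightarrow> complex^'n" and d :: "'n \<Rightarrow> complex"
  assumes e: "\<And>i j. cip (e i) (e j) = (if i = j then 1 else 0)"
    and d: "\<And>i. Z *v e i = d i *s e i"
  shows "charpoly Z = (\<Prod>i\<in>UNIV. [:- d i, 1:])"
proof (rule poly_eq_poly_eq_iff[THEN iffD1], rule ext)
  fix z
  define Q :: "complex^'n^'n" where "Q = (\<chi> i j. e j $ i)"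
  define N where "N = (\<chi> i j. (if i = j then z else 0) - Z $ i $ j)"
  define D :: "complex^'n^'n" where "D = (\<chi> i j. if i = j then z - d j else 0)"
  have QQ: "adjoint_mat Q ** Q = mat 1"
    by (rule orthonormal_columns_unitary[OF e Q_def])
  have "(\<Sum>k\<in>UNIV. Z $ i $ k * e j $ k) = d j * e j $ i" for i j
    using arg_cong[OF d[of j], of "\<lambda>v. v $ i"] by (simp add: matrix_vector_mult_def)
  then have "N ** Q = Q ** D"
    by (simp add: N_def Q_def D_def matrix_matrix_mult_def vec_eq_iff left_diff_distrib sum_subtractf
        mult_delta_left mult_delta_right algebra_simps)
  then have "det N * det Q = det Q * det D"
    by (metis det_mul)
  moreover have "det Q \<noteq> 0"
    using det_mul[of "adjoint_mat Q" Q] QQ by auto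
  ultimately have "det N = det D" by simp
  also have "\<dots> = (\<Prod>i\<in>UNIV. z - d i)"
    by (subst det_diagonal) (auto simp: D_def)
  finally show "poly (charpoly Z) z = poly (\<Prod>i\<in>UNIV. [:- d i, 1:]) z"
    by (simp add: poly_charpoly N_def poly_prod)
qed

lemma alg_mult_diagonalized:
  fixes Z :: "complex^'n^'n" and e :: "'n \<Rightarrow> complex^'n" and d :: "'n \<Rightarrow> complex"
  assumes "\<And>i j. cip (e i) (e j) = (if i = j then 1 else 0)"
    and "\<And>i. Z *v e i = d i *s e i"
  shows "alg_mult Z z = card {i. d i = z}"
proof -
  have "order z (\<Prod>i\<in>I. [:- d i, 1:]) = card {i\<in>I. d i = z}" if "finite I" for I
    using that
  proof induction
    case (insert k I)
    have "(\<Prod>i\<in>insert k I. [:- d i, 1:]) \<noteq> 0"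
      using insert.hyps by (subst prod_zero_iff) auto
    moreover have "order z [:- d k, 1:] = (if d k = z then 1 else 0)"
      using order_power_n_n[of z 1] by (auto simp: order_0I)
    moreover have "{i \<in> insert k I. d i = z} = (if d k = z then insert k {i\<in>I. d i = z} else {i\<in>I. d i = z})"
      by auto
    moreover have split: "(\<Prod>i\<in>insert k I. [:- d i, 1:]) = [:- d k, 1:] * (\<Prod>i\<in>I. [:- d i, 1:])"
      using insert.hyps by simp
    ultimately have "order z (\<Prod>i\<in>insert k I. [:- d i, 1:]) = (if d k = z then 1 else 0) + card {i\<in>I. d i = z}"
      by (simp only: split order_mult insert.IH not_False_eq_True)
    then show ?case
      using insert.hyps \<open>{i \<in> insert k I. d i = z} = _\<close> by simp
  qed simp
  from this[of UNIV] show ?thesis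
    by (simp add: alg_mult_def charpoly_diagonalized[OF assms])
qed

text \<open>
  Counting eigenvalues with algebraic multiplicity amounts to counting the indices of an eigenbasis. The
  lemma is applied with \<open>P\<close> selecting the positive and the negative eigenvalues.
\<close>

lemma sum_alg_mult_diagonalized:
  fixes Z :: "complex^'n^'n" and e :: "'n \<Rightarrow> complex^'n" and d :: "'n \<Rightarrow> real"
  assumes e: "\<And>i j. cip (e i) (e j) = (if i = j then 1 else 0)"
    and d: "\<And>i. Z *v e i = of_real (d i) *s e i"
  shows "(\<Sum>r\<in>{r. P r \<and> eigenval Z (of_real r)}. alg_mult Z (of_real r)) = card {i. P (d i)}"
proof -
  note a = alg_mult_diagonalized[OF e d]
  have ev: "eigenval Z (of_real r) \<longleftrightarrow> r \<in> range d" for r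
    by (auto simp: eigenval_iff_root charpoly_diagonalized[OF e d] poly_prod)
  have "(\<Sum>r\<in>{r. P r \<and> eigenval Z (of_real r)}. alg_mult Z (of_real r))
      = (\<Sum>r\<in>{r \<in> range d. P r}. card {i. d i = r})"
    by (intro sum.cong) (auto simp: ev a)
  also have "\<dots> = card (\<Union>r\<in>{r \<in> range d. P r}. {i. d i = r})"
    by (rule card_UN_disjoint[symmetric]) auto
  also have "(\<Union>r\<in>{r \<in> range d. P r}. {i. d i = r}) = {i. P (d i)}" by auto
  finally show ?thesis .
qed

section \<open>Inertia bounds\<close>

text \<open>
  On the span of the eigenvectors whose eigenvalues have the sign of \<open>s\<close> the form of \<open>Z\<close> is definite, while
  it vanishes on the kernel of \<open>B\<^sup>*\<close>. The two spaces therefore meet only in \<open>0\<close>, that is, \<open>B\<^sup>*\<close> is injective on the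
  first one and maps it into a space of dimension \<open>m\<close>. Positive and negative eigenvalues are the cases \<open>s = 1\<close> and
  \<open>s = - 1\<close>.
\<close>

lemma card_same_sign_le:
  fixes Z :: "complex^'n^'n" and B :: "complex^'m^'n" and e :: "'n \<Rightarrow> complex^'n" and d :: "'n \<Rightarrow> real"
  assumes e: "\<And>i j. cip (e i) (e j) = (if i = j then 1 else 0)"
    and d: "\<And>i. Z *v e i = of_real (d i) *s e i"
    and zero: "\<And>v. adjoint_mat B *v v = 0 \<Longrightarrow> Re (cip v (Z *v v)) = 0"
  shows "card {i. 0 < s * d i} \<le> CARD('m)"
proof -
  define I where "I = {i. 0 < s * d i}"
  define f where "f c = adjoint_mat B *v (\<Sum>i\<in>UNIV. (c $ i) *s e i)" for c
  have "vec.dim {c::complex^'n. \<forall>i. i \<notin> I \<longrightarrow> c $ i = 0} \<le> vec.dim (UNIV :: (complex^'m) set)"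
  proof (rule dim_le_if_injective[of _ f])
    show "vec.subspace {c::complex^'n. \<forall>i. i \<notin> I \<longrightarrow> c $ i = 0}"
      by (auto simp: vec.subspace_def)
    show "Vector_Spaces.linear (*s) (*s) f"
      by unfold_locales
        (simp_all add: f_def vec.add vec.sum vec.scale vec.scale_left_distrib sum.distrib vec.scale_sum_right)
    fix c :: "complex^'n"
    assume c: "c \<in> {c. \<forall>i. i \<notin> I \<longrightarrow> c $ i = 0}" and "f c = 0"
    define v where "v = (\<Sum>i\<in>UNIV. (c $ i) *s e i)"
    have cv: "cip (e i) v = c $ i" for i
      unfolding v_def by (rule cip_orthonormal_sum[OF e])
    have "Re (cip v (Z *v v)) = 0" using \<open>f c = 0\<close> zero by (simp add: f_def v_def)
    then have "(\<Sum>i\<in>UNIV. s * d i * (norm (c $ i))\<^sup>2) = 0"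
      by (simp add: form_diagonalized[OF e d] cv mult.assoc flip: sum_distrib_left)
    moreover have "0 \<le> s * d i * (norm (c $ i))\<^sup>2" for i
      using c by (cases "i \<in> I") (auto simp: I_def)
    ultimately have zero: "s * d i * (norm (c $ i))\<^sup>2 = 0" for i
      by (auto simp: sum_nonneg_eq_0_iff)
    have "c $ i = 0" for i
      using c zero[of i] by (cases "i \<in> I") (auto simp: I_def)
    then show "c = 0" by (simp add: vec_eq_iff)
  qed simp
  then show ?thesis
    unfolding dim_substandard_cart by (simp add: vec.dim_UNIV card_cart_basis I_def)
qed

text \<open>
  A vector without components along the eigenvectors of positive eigenvalues has \<open>v\<^sup>* Z v \<le> 0\<close>, so the projection
  onto these components is injective on a subspace on which the form is positive definite.
\<close>

lemma dim_le_card_pos: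
  fixes Z :: "complex^'n^'n" and e :: "'n \<Rightarrow> complex^'n" and d :: "'n \<Rightarrow> real"
  assumes e: "\<And>i j. cip (e i) (e j) = (if i = j then 1 else 0)"
    and d: "\<And>i. Z *v e i = of_real (d i) *s e i"
    and S: "vec.subspace S" and pos: "\<And>v. v \<in> S \<Longrightarrow> v \<noteq> 0 \<Longrightarrow> 0 < Re (cip v (Z *v v))"
  shows "vec.dim S \<le> card {i. 0 < d i}"
proof -
  define f :: "complex^'n \<Rightarrow> complex^'n" where "f v = (\<chi> i. if 0 < d i then cip (e i) v else 0)" for v
  have "vec.dim S \<le> vec.dim {c::complex^'n. \<forall>i. i \<notin> {i. 0 < d i} \<longrightarrow> c $ i = 0}"
  proof (rule dim_le_if_injective[OF S])
    show "Vector_Spaces.linear (*s) (*s) f"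
      by unfold_locales (auto simp: f_def vec_eq_iff cip_add_right cip_scale_right)
    fix v assume "v \<in> S" "f v = 0"
    then have "cip (e i) v = 0" if "0 < d i" for i
      using that by (auto simp: f_def vec_eq_iff split: if_splits)
    then have "d i * (norm (cip (e i) v))\<^sup>2 \<le> 0" for i
      by (cases "0 < d i") (auto simp: mult_nonpos_nonneg)
    then have "Re (cip v (Z *v v)) \<le> 0"
      unfolding form_diagonalized[OF e d] by (intro sum_nonpos)
    then show "v = 0" using pos[OF \<open>v \<in> S\<close>] by force
  qed (auto simp: f_def)
  then show ?thesis by (simp only: dim_substandard_cart)
qed

text \<open>
  For a left eigenvector \<open>v\<close> of \<open>A\<close> one has \<open>v\<^sup>* Z v = - 2 Re z (v\<^sup>* X v) > 0\<close>, but the geometric multiplicity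
  counts right eigenvectors. Instead of comparing the two eigenspaces, the right eigenspace is pulled back along \<open>X\<close>: with
  \<open>A X v = z X v\<close> the same computation of \<open>v\<^sup>* Z v\<close> goes through, and \<open>X\<close>, being invertible, preserves the dimension.
\<close>

lemma geo_mult_le_card_pos:
  fixes A X Z :: "complex^'n^'n" and e :: "'n \<Rightarrow> complex^'n" and d :: "'n \<Rightarrow> real"
  assumes e: "\<And>i j. cip (e i) (e j) = (if i = j then 1 else 0)"
    and d: "\<And>i. Z *v e i = of_real (d i) *s e i"
    and X: "pos_def_mat X" and lyap: "A ** X + X ** adjoint_mat A = - Z"
    and z: "Re z < 0"
  shows "geo_mult A z \<le> card {i. 0 < d i}"
proof -
  have herm: "hermitian_mat X" and Xpos: "\<And>v. v \<noteq> 0 \<Longrightarrow> 0 < Re (cip v (X *v v))"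
    using X by (auto simp: pos_def_mat_def cip_def)
  define F where "F = {v. A *v (X *v v) = z *s (X *v v)}"
  have "v = 0" if "X *v v = 0" for v
    using that Xpos[of v] by (cases "v = 0") (auto simp: cip_zero_right)
  then have "inj ((*v) X)"
    by (simp add: vec.inj_iff_eq_0)
  then have "surj ((*v) X)"
    using vec.linear_injective_imp_surjective[OF vec.linear_axioms _ refl] by blast
  then have "{v. A *v v = z *s v} \<subseteq> (*v) X ` F"
    unfolding F_def by (auto simp: surj_def)
  then have "geo_mult A z \<le> vec.dim ((*v) X ` F)"
    unfolding geo_mult_def by (rule vec.dim_subset)
  also have "\<dots> \<le> vec.dim F"
    by (rule vec.dim_image_le[OF vec.linear_axioms])
  also have "\<dots> \<le> card {i. 0 < d i}"
  proof (rule dim_le_card_pos[OF e d])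
    show "vec.subspace F"
      by (auto simp: F_def vec.subspace_def vec.add vec.scale vec.scale_right_distrib mult.commute)
    fix v assume "v \<in> F" "v \<noteq> 0"
    have "cip v (X *v v) = cnj (cip v (X *v v))"
      using herm cip_adjoint[of v X v] cip_commute[of "X *v v" v] by (simp add: hermitian_mat_def)
    then have "Im (cip v (X *v v)) = 0"
      by (metis Im_complex_of_real Reals_cnj_iff complex_is_Real_iff)
    then have "Re (cip v (Z *v v)) = - 2 * (Re z * Re (cip v (X *v v)))"
      using \<open>v \<in> F\<close> by (simp add: lyapunov_form[OF herm lyap] F_def cip_scale_right)
    moreover have "Re z * Re (cip v (X *v v)) < 0"
      using z Xpos[OF \<open>v \<noteq> 0\<close>] by (rule mult_neg_pos)
    ultimately show "0 < Re (cip v (Z *v v))" by simp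
  qed
  finally show ?thesis .
qed

theorem proposition3:
  fixes A X Z :: "complex^'n^'n" and B :: "complex^'m^'n"
    and M :: "'w measure"
    and U :: "real \<Rightarrow> 'w \<Rightarrow> complex^'m" and x :: "real \<Rightarrow> 'w \<Rightarrow> complex^'n"
  assumes "CARD('m) \<le> CARD('n)"
    and "hurwitz A"
    and "controllable A B"
    and "prob_space M"
    and "integrated_stationary_input M U"
    and "state_process M A B U x"
    and "steady_state_covariance M x X"
    and "pos_def_mat X"
    and "A ** X + X ** adjoint_mat A = - Z"
  shows "0 \<le> num_neg_eigenvals Z \<and> num_neg_eigenvals Z \<le> CARD('m)
    \<and> max_geo_mult A \<le> num_pos_eigenvals Z \<and> num_pos_eigenvals Z \<le> CARD('m)"
proof -
  have X: "hermitian_mat X" using \<open>pos_def_mat X\<close> by (simp add: pos_def_mat_def)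
  note lyap = \<open>A ** X + X ** adjoint_mat A = - Z\<close>
  obtain e :: "'n \<Rightarrow> complex^'n" and d :: "'n \<Rightarrow> real"
    where e: "\<And>i j. cip (e i) (e j) = (if i = j then 1 else 0)"
      and d: "\<And>i. Z *v e i = of_real (d i) *s e i"
    using hermitian_orthonormal_eigenvectors[OF lyapunov_hermitian[OF X lyap]] by blast
  have pos: "num_pos_eigenvals Z = card {i. 0 < d i}"
    unfolding num_pos_eigenvals_def by (rule sum_alg_mult_diagonalized[OF e d])
  have neg: "num_neg_eigenvals Z = card {i. d i < 0}"
    unfolding num_neg_eigenvals_def by (rule sum_alg_mult_diagonalized[OF e d])
  have "card {i. 0 < s * d i} \<le> CARD('m)" for s
    by (rule card_same_sign_le[OF e d steady_state_form_zero[OF assms(4,6,7) X lyap]])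
  from this[of 1] this[of "- 1"] have "num_pos_eigenvals Z \<le> CARD('m)" "num_neg_eigenvals Z \<le> CARD('m)"
    by (simp_all add: pos neg)
  \<comment> \<open>\<open>Max\<close> has its intended meaning here because \<open>A\<close> has finitely many eigenvalues and at least one.\<close>
  moreover have "max_geo_mult A \<le> num_pos_eigenvals Z"
    unfolding max_geo_mult_def pos
  proof (rule Max.boundedI)
    fix k assume "k \<in> geo_mult A ` {z. eigenval A z}"
    then obtain z where "eigenval A z" "k = geo_mult A z" by blast
    moreover from this have "Re z < 0" using \<open>hurwitz A\<close> by (simp add: hurwitz_def)
    ultimately show "k \<le> card {i. 0 < d i}"
      using geo_mult_le_card_pos[OF e d \<open>pos_def_mat X\<close> lyap] by simp
  qed (use finite_eigenvals eigenval_exists in auto)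
  ultimately show ?thesis by simp
qed

end
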